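(* Let $\Omega\subset\mathbb{R}^3$ be a bounded domain with compact, oriented, smooth boundary $\Gamma$, let $\mu>0$ and $T>0$. If $u(t,x)$ (with pressure $p$) is a smooth solution in $\Omega_T=\Omega\times(0,T]$ of the Navier-Stokes equations $$\partial_tu+u\cdot\nabla u+\nabla p=\mu\Delta u,\qquad\nabla\cdot u=0,$$ subject to the boundary conditions $u^\perp|_\Gamma=0$ and $(\nabla\times u)^\Vert|_\Gamma=a$, then $p$ solves the Neumann problem $$\Delta p=-\nabla\cdot(u\cdot\nabla u)\ \text{ in }\Omega,\qquad\partial_\nu p|_\Gamma=\pi(u,u)-\mu\,\nabla^\Gamma\times a .$$
   Context: $\nu$ is the outward unit normal on $\Gamma$; $u^\perp=\langle u,\nu\rangle$ and $u^\Vert=u-\langle u,\nu\rangle\nu$ are the normal component and tangential part on $\Gamma$. "Smooth solution" means smooth up to the boundary. $a=a(t,x)$ is a tangential field on $\Gamma$. $\pi(X,Y)=\langle\nabla_X\nu,Y\rangle$ is the second fundamental form of $\Gamma$. $\nabla^\Gamma\times a=\nabla^\Gamma_1a^2-\nabla^\Gamma_2a^1$ in any local orthonormal frame $(e_1,e_2)$ of $T\Gamma$ with $(e_1,e_2,\nu)$ positively oriented, $\nabla^\Gamma$ being the Levi-Civita connection of $\Gamma$. *)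

theory Defs
  imports "HOL-Analysis.Analysis"
begin

section \<open>Smooth functions\<close>

text \<open>\<open>Ck_on k V f\<close> is meant for open \<open>V\<close>: \<open>f\<close> is \<open>k\<close> times continuously differentiable there.\<close>

primrec Ck_on ::
  "nat \<Rightarrow> 'a::euclidean_space set \<Rightarrow> ('a \<Rightarrow> 'b::real_normed_vector) \<Rightarrow> bool" where
  "Ck_on 0 V f \<longleftrightarrow> continuous_on V f"
| "Ck_on (Suc k) V f \<longleftrightarrow> (\<forall>x\<in>V. f differentiable (at x)) \<and>
     (\<forall>v. Ck_on k V (\<lambda>x. frechet_derivative f (at x) v))"

text \<open>Smoothness on an arbitrary set: near each of its points the function has a
  \<open>C\<^sup>\<infinity>\<close> extension to an open set. For open sets this is the usual notion, for the closure of
  a domain it is smoothness up to the boundary, and for a submanifold it is smoothness on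
  that submanifold.\<close>

definition smooth_on ::
  "'a::euclidean_space set \<Rightarrow> ('a \<Rightarrow> 'b::real_normed_vector) \<Rightarrow> bool" where
  "smooth_on S f \<longleftrightarrow> (\<forall>x\<in>S. \<exists>V g. open V \<and> x \<in> V \<and> (\<forall>k. Ck_on k V g) \<and>
     (\<forall>y\<in>V \<inter> S. g y = f y))"

section \<open>Vector calculus on subsets of three-space\<close>

text \<open>The set \<open>S\<close> is where the function is considered. At an interior point of \<open>S\<close> these are the
  ordinary derivatives; for \<open>S\<close> the closure of a smooth domain they are still uniquely
  determined at boundary points, namely the boundary values of the interior derivatives.\<close>

definition partial ::
  "(real^3) set \<Rightarrow> 3 \<Rightarrow> (real^3 \<Rightarrow> 'b::real_normed_vector) \<Rightarrow> real^3 \<Rightarrow> 'b" where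
  "partial S i f x = frechet_derivative f (at x within S) (axis i 1)"

definition grad :: "(real^3) set \<Rightarrow> (real^3 \<Rightarrow> real) \<Rightarrow> real^3 \<Rightarrow> real^3" where
  "grad S f x = (\<chi> i. partial S i f x)"

definition divergence :: "(real^3) set \<Rightarrow> (real^3 \<Rightarrow> real^3) \<Rightarrow> real^3 \<Rightarrow> real" where
  "divergence S w x = (\<Sum>i\<in>UNIV. partial S i (\<lambda>y. w y $ i) x)"

definition curl :: "(real^3) set \<Rightarrow> (real^3 \<Rightarrow> real^3) \<Rightarrow> real^3 \<Rightarrow> real^3" where
  "curl S w x = vector
     [partial S 2 (\<lambda>y. w y $ 3) x - partial S 3 (\<lambda>y. w y $ 2) x,
      partial S 3 (\<lambda>y. w y $ 1) x - partial S 1 (\<lambda>y. w y $ 3) x,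
      partial S 1 (\<lambda>y. w y $ 2) x - partial S 2 (\<lambda>y. w y $ 1) x]"

definition laplacian ::
  "(real^3) set \<Rightarrow> (real^3 \<Rightarrow> 'b::real_normed_vector) \<Rightarrow> real^3 \<Rightarrow> 'b" where
  "laplacian S f x = (\<Sum>i\<in>UNIV. partial S i (partial S i f) x)"

definition advection ::
  "(real^3) set \<Rightarrow> (real^3 \<Rightarrow> real^3) \<Rightarrow> (real^3 \<Rightarrow> real^3) \<Rightarrow> real^3 \<Rightarrow> real^3" where
  "advection S v w x = (\<Sum>i\<in>UNIV. (v x $ i) *\<^sub>R partial S i w x)"

section \<open>Domains with smooth boundary\<close>

definition bounded_smooth_domain :: "(real^3) set \<Rightarrow> bool" where
  "bounded_smooth_domain \<Omega> \<longleftrightarrow> \<Omega> \<noteq> {} \<and> open \<Omega> \<and> connected \<Omega> \<and> bounded \<Omega> \<and>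
     (\<forall>x\<in>frontier \<Omega>. \<exists>V \<rho>. open V \<and> x \<in> V \<and> smooth_on V \<rho> \<and>
        (\<forall>y\<in>V. grad V \<rho> y \<noteq> 0) \<and> \<Omega> \<inter> V = {y\<in>V. \<rho> y < 0})"

definition tangent_space :: "(real^3) set \<Rightarrow> real^3 \<Rightarrow> (real^3) set" where
  "tangent_space M x = {v. \<exists>\<gamma> \<epsilon>. 0 < \<epsilon> \<and> \<gamma> 0 = x \<and> (\<forall>s::real. \<bar>s\<bar> < \<epsilon> \<longrightarrow> \<gamma> s \<in> M) \<and>
     (\<gamma> has_vector_derivative v) (at 0)}"

definition outward_unit_normal :: "(real^3) set \<Rightarrow> (real^3 \<Rightarrow> real^3) \<Rightarrow> bool" where
  "outward_unit_normal \<Omega> \<nu> \<longleftrightarrow> (\<forall>x\<in>frontier \<Omega>. norm (\<nu> x) = 1 \<and>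
     (\<forall>v\<in>tangent_space (frontier \<Omega>) x. v \<bullet> \<nu> x = 0) \<and>
     (\<exists>\<epsilon>>0. \<forall>s. 0 < s \<and> s < \<epsilon> \<longrightarrow> x + s *\<^sub>R \<nu> x \<notin> closure \<Omega>))"

definition tangential_part :: "real^3 \<Rightarrow> real^3 \<Rightarrow> real^3" where
  "tangential_part n w = w - (w \<bullet> n) *\<^sub>R n"

section \<open>Geometry of a surface\<close>

text \<open>\<open>surface_deriv M f x v\<close> is meant for \<open>v\<close> tangent to \<open>M\<close> at \<open>x\<close>. A derivative of \<open>f\<close> within
  the surface is determined by \<open>f\<close> on tangent vectors only, so there the choice made by
  \<^const>\<open>frechet_derivative\<close> is immaterial.\<close>

definition surface_deriv ::
  "(real^3) set \<Rightarrow> (real^3 \<Rightarrow> 'b::real_normed_vector) \<Rightarrow> real^3 \<Rightarrow> real^3 \<Rightarrow> 'b" where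
  "surface_deriv M f x v = frechet_derivative f (at x within M) v"

definition second_fundamental_form ::
  "(real^3) set \<Rightarrow> (real^3 \<Rightarrow> real^3) \<Rightarrow> real^3 \<Rightarrow> real^3 \<Rightarrow> real^3 \<Rightarrow> real" where
  "second_fundamental_form M \<nu> x v w = surface_deriv M \<nu> x v \<bullet> w"

definition tangent_field :: "(real^3) set \<Rightarrow> (real^3 \<Rightarrow> real^3) \<Rightarrow> bool" where
  "tangent_field M X \<longleftrightarrow> (\<forall>x\<in>M. X x \<in> tangent_space M x)"

definition smooth_tangent_field :: "(real^3) set \<Rightarrow> (real^3 \<Rightarrow> real^3) \<Rightarrow> bool" where
  "smooth_tangent_field M X \<longleftrightarrow> smooth_on M X \<and> tangent_field M X"

definition lie_bracket ::
  "(real^3) set \<Rightarrow> (real^3 \<Rightarrow> real^3) \<Rightarrow> (real^3 \<Rightarrow> real^3) \<Rightarrow> real^3 \<Rightarrow> real^3" where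
  "lie_bracket M X Y x = surface_deriv M Y x (X x) - surface_deriv M X x (Y x)"

text \<open>\<open>D Y x v\<close> stands for the covariant derivative of the field \<open>Y\<close> at \<open>x\<close> in the tangent
  direction \<open>v\<close>.\<close>

definition affine_connection ::
  "(real^3) set \<Rightarrow> ((real^3 \<Rightarrow> real^3) \<Rightarrow> real^3 \<Rightarrow> real^3 \<Rightarrow> real^3) \<Rightarrow> bool" where
  "affine_connection M D \<longleftrightarrow>
     (\<forall>X Y. smooth_tangent_field M X \<and> smooth_tangent_field M Y \<longrightarrow>
        smooth_tangent_field M (\<lambda>x. D Y x (X x))) \<and>
     (\<forall>Y. smooth_tangent_field M Y \<longrightarrow>
        (\<forall>x\<in>M. \<forall>v\<in>tangent_space M x. \<forall>w\<in>tangent_space M x. \<forall>c d.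
           D Y x (c *\<^sub>R v + d *\<^sub>R w) = c *\<^sub>R D Y x v + d *\<^sub>R D Y x w)) \<and>
     (\<forall>Y Z. smooth_tangent_field M Y \<and> smooth_tangent_field M Z \<longrightarrow>
        (\<forall>x\<in>M. \<forall>v\<in>tangent_space M x. D (\<lambda>y. Y y + Z y) x v = D Y x v + D Z x v)) \<and>
     (\<forall>f Y. smooth_on M f \<and> smooth_tangent_field M Y \<longrightarrow>
        (\<forall>x\<in>M. \<forall>v\<in>tangent_space M x.
           D (\<lambda>y. f y *\<^sub>R Y y) x v = surface_deriv M f x v *\<^sub>R Y x + f x *\<^sub>R D Y x v))"

definition is_levi_civita ::
  "(real^3) set \<Rightarrow> ((real^3 \<Rightarrow> real^3) \<Rightarrow> real^3 \<Rightarrow> real^3 \<Rightarrow> real^3) \<Rightarrow> bool" where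
  "is_levi_civita M D \<longleftrightarrow> affine_connection M D \<and>
     (\<forall>Y Z. smooth_tangent_field M Y \<and> smooth_tangent_field M Z \<longrightarrow>
        (\<forall>x\<in>M. \<forall>v\<in>tangent_space M x.
           surface_deriv M (\<lambda>y. Y y \<bullet> Z y) x v = D Y x v \<bullet> Z x + Y x \<bullet> D Z x v)) \<and>
     (\<forall>X Y. smooth_tangent_field M X \<and> smooth_tangent_field M Y \<longrightarrow>
        (\<forall>x\<in>M. D Y x (X x) - D X x (Y x) = lie_bracket M X Y x))"

text \<open>The conditions determine \<open>D Y x v\<close> for smooth tangent fields \<open>Y\<close> and tangent vectors \<open>v\<close>
  at \<open>x \<in> M\<close>; the choice only concerns irrelevant arguments.\<close>

definition levi_civita ::
  "(real^3) set \<Rightarrow> (real^3 \<Rightarrow> real^3) \<Rightarrow> real^3 \<Rightarrow> real^3 \<Rightarrow> real^3" where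
  "levi_civita M = (SOME D. is_levi_civita M D)"

definition oriented_frame ::
  "(real^3) set \<Rightarrow> (real^3 \<Rightarrow> real^3) \<Rightarrow> (real^3) set \<Rightarrow>
   (real^3 \<Rightarrow> real^3) \<Rightarrow> (real^3 \<Rightarrow> real^3) \<Rightarrow> bool" where
  "oriented_frame M \<nu> U e1 e2 \<longleftrightarrow> openin (top_of_set M) U \<and> smooth_on U e1 \<and> smooth_on U e2 \<and>
     (\<forall>y\<in>U. e1 y \<in> tangent_space M y \<and> e2 y \<in> tangent_space M y \<and>
        norm (e1 y) = 1 \<and> norm (e2 y) = 1 \<and> e1 y \<bullet> e2 y = 0 \<and>
        0 < det (vector [e1 y, e2 y, \<nu> y] :: real^3^3))"

text \<open>The value is the same for all oriented orthonormal frames around \<open>x\<close>.\<close>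

definition surface_curl ::
  "(real^3) set \<Rightarrow> (real^3 \<Rightarrow> real^3) \<Rightarrow> (real^3 \<Rightarrow> real^3) \<Rightarrow> real^3 \<Rightarrow> real" where
  "surface_curl M \<nu> a x = (THE c. \<exists>U e1 e2. oriented_frame M \<nu> U e1 e2 \<and> x \<in> U \<and>
     c = levi_civita M a x (e1 x) \<bullet> e2 x - levi_civita M a x (e2 x) \<bullet> e1 x)"

end

theory Submission
  imports Defs
begin

text \<open>
  Smoothness up to the boundary extends the momentum equation and the divergence constraint by
  continuity to the closure of \<open>\<Omega>\<close>. Taking the divergence of the momentum equation kills
  \<open>\<partial>\<^sub>t u\<close> and \<open>\<Delta> u\<close>, which gives the Poisson equation. On the boundary, take the normal
  component instead: \<open>\<partial>\<^sub>t u\<close> is tangential, differentiating \<open>u \<bullet> \<nu> = 0\<close> along \<open>u\<close> turns the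
  advection term into \<open>- \<pi>(u, u)\<close>, and \<open>\<Delta> u = - \<nabla> \<times> (\<nabla> \<times> u)\<close>. The normal component of
  \<open>\<nabla> \<times> \<omega>\<close> is the surface curl of the tangential part of \<open>\<omega>\<close>: the normal part of \<open>\<omega>\<close>
  only contributes a multiple of \<open>\<pi>(e\<^sub>1, e\<^sub>2) - \<pi>(e\<^sub>2, e\<^sub>1) = 0\<close>.
\<close>

section \<open>Calculus of \<open>C\<^sup>k\<close> functions\<close>

text \<open>The derivatives in the statement are choices: \<open>frechet_derivative\<close> within a
  closed set or a surface, \<open>levi_civita\<close> by \<open>SOME\<close>,
  \<open>surface_curl\<close> by \<open>THE\<close>. Smoothness, in turn, only provides local
  extensions, which need not satisfy any of the equations outside the set. Each derivative is
  therefore shown to be determined by the function on the set, on all vectors over the closure and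
  on tangent vectors along the boundary, and is then computed from an extension, where the usual
  rules hold. The time interval is closed at \<open>T\<close>, where the constraints are known for
  earlier times only; they are differentiated in time from the left. The Levi-Civita connection has
  to be identified before the surface curl can be evaluated. It is the tangential projection of the
  ambient derivative, and its torsion-freeness rests on the same symmetry of
  \<open>second_fundamental_form\<close> that removes the normal part of the vorticity.\<close>

lemma Ck_on_subset: "Ck_on k V f \<Longrightarrow> W \<subseteq> V \<Longrightarrow> Ck_on k W f"
  by (induction k arbitrary: f) (auto intro: continuous_on_subset)

lemma Ck_on_cong:
  assumes "open V" "\<And>x. x \<in> V \<Longrightarrow> f x = g x"
  shows "Ck_on k V f \<longleftrightarrow> Ck_on k V g"
  using assms(2)
proof (induction k arbitrary: f g)
  case 0
  then show ?case by (simp cong: continuous_on_cong)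
next
  case (Suc k)
  have d: "f differentiable at x \<longleftrightarrow> g differentiable at x" if "x \<in> V" for x
  proof
    assume "f differentiable at x"
    then obtain D where "(f has_derivative D) (at x)" by (auto simp: differentiable_def)
    then have "(g has_derivative D) (at x)"
      by (rule has_derivative_transform_within_open[OF _ assms(1) that Suc.prems])
    then show "g differentiable at x" by (auto simp: differentiable_def)
  next
    assume "g differentiable at x"
    then obtain D where "(g has_derivative D) (at x)" by (auto simp: differentiable_def)
    then have "(f has_derivative D) (at x)"
      by (rule has_derivative_transform_within_open[OF _ assms(1) that Suc.prems[symmetric]])
    then show "f differentiable at x" by (auto simp: differentiable_def)
  qed
  show ?case
  proof (cases "\<forall>x\<in>V. f differentiable at x")
    case True
    have "frechet_derivative f (at x) v = frechet_derivative g (at x) v" if "x \<in> V" for x v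
      using frechet_derivative_transform_within_open[of f x V g] True that assms(1) Suc.prems by auto
    then have "Ck_on k V (\<lambda>x. frechet_derivative f (at x) v) \<longleftrightarrow>
        Ck_on k V (\<lambda>x. frechet_derivative g (at x) v)" for v
      by (intro Suc.IH) auto
    with d show ?thesis by auto
  next
    case False
    with d show ?thesis by auto
  qed
qed

text \<open>A rule of differentiation may supply the derivative \<open>f'\<close>, instead of the
  choice made by \<open>frechet_derivative\<close>. The closure properties below run through this
  rule by induction on \<open>k\<close>.\<close>

lemma Ck_on_SucI:
  assumes "open V" "\<And>x. x \<in> V \<Longrightarrow> (f has_derivative f' x) (at x)"
    and "\<And>v. Ck_on k V (\<lambda>x. f' x v)"
  shows "Ck_on (Suc k) V f"
proof -
  have "frechet_derivative f (at x) = f' x" if "x \<in> V" for x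
    using frechet_derivative_at[OF assms(2)[OF that]] by simp
  then have "Ck_on k V (\<lambda>x. frechet_derivative f (at x) v)" for v
    by (intro iffD2[OF Ck_on_cong[OF assms(1)] assms(3)]) simp
  with assms(2) show ?thesis by (auto simp: differentiable_def)
qed

lemma Ck_on_Suc_has_derivative:
  assumes "Ck_on (Suc k) V f" "x \<in> V"
  shows "(f has_derivative frechet_derivative f (at x)) (at x)"
  using assms by (simp flip: frechet_derivative_works)

lemma Ck_on_2_has_derivative:
  assumes "Ck_on 2 V f" "x \<in> V"
  shows "(f has_derivative frechet_derivative f (at x)) (at x)"
    and "((\<lambda>y. frechet_derivative f (at y) v) has_derivative
      frechet_derivative (\<lambda>y. frechet_derivative f (at y) v) (at x)) (at x)"
  using assms by (simp_all add: numeral_2_eq_2 flip: frechet_derivative_works)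

lemma Ck_on_SucD: "Ck_on (Suc k) V f \<Longrightarrow> Ck_on k V f"
proof (induction k arbitrary: f)
  case 0
  then show ?case
    by (auto intro!: continuous_at_imp_continuous_on differentiable_imp_continuous_within)
next
  case (Suc k)
  then show ?case by auto
qed

lemma Ck_on_const: "Ck_on k V (\<lambda>x. c)"
  by (induction k arbitrary: c) auto

lemma Ck_on_linear_compose:
  assumes "open V" "bounded_linear L" "Ck_on k V f"
  shows "Ck_on k V (\<lambda>x. L (f x))"
  using assms(3)
proof (induction k arbitrary: f)
  case 0
  then show ?case
    using bounded_linear.continuous_on[OF assms(2)] by simp
next
  case (Suc k)
  show ?case
  proof (rule Ck_on_SucI[OF assms(1)])
    fix x assume "x \<in> V"
    show "((\<lambda>x. L (f x)) has_derivative (\<lambda>v. L (frechet_derivative f (at x) v))) (at x)"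
      by (rule bounded_linear.has_derivative[OF assms(2)])
        (rule Ck_on_Suc_has_derivative[OF Suc.prems \<open>x \<in> V\<close>])
  qed (use Suc in auto)
qed

lemma Ck_on_add:
  assumes "open V" "Ck_on k V f" "Ck_on k V g"
  shows "Ck_on k V (\<lambda>x. f x + g x)"
  using assms(2,3)
proof (induction k arbitrary: f g)
  case 0
  then show ?case by (simp add: continuous_on_add)
next
  case (Suc k)
  show ?case
    by (rule Ck_on_SucI[OF assms(1)
          has_derivative_add[OF Ck_on_Suc_has_derivative[OF Suc.prems(1)]
            Ck_on_Suc_has_derivative[OF Suc.prems(2)]]])
      (use Suc in auto)
qed

lemma Ck_on_sum:
  assumes "open V" "\<And>i. i \<in> I \<Longrightarrow> Ck_on k V (f i)"
  shows "Ck_on k V (\<lambda>x. \<Sum>i\<in>I. f i x)"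
  using assms(2)
  by (induction I rule: infinite_finite_induct) (auto intro: Ck_on_const Ck_on_add[OF assms(1)])

text \<open>The product rule gives two bilinear terms, each with one differentiated factor; the
  other factor loses one order by \<open>Ck_on_SucD\<close>. One lemma thus covers scalar multiples,
  inner products and cross products.\<close>

lemma Ck_on_bilinear:
  assumes "open V" "bounded_bilinear B" "Ck_on k V f" "Ck_on k V g"
  shows "Ck_on k V (\<lambda>x. B (f x) (g x))"
  using assms(3,4)
proof (induction k arbitrary: f g)
  case 0
  then show ?case using bounded_bilinear.continuous_on[OF assms(2)] by simp
next
  case (Suc k)
  show ?case
    by (rule Ck_on_SucI[OF assms(1)
          bounded_bilinear.FDERIV[OF assms(2) Ck_on_Suc_has_derivative[OF Suc.prems(1)]
            Ck_on_Suc_has_derivative[OF Suc.prems(2)]]])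
      (use Suc in \<open>auto intro!: Ck_on_add[OF assms(1)] Suc.IH intro: Ck_on_SucD simp del: Ck_on.simps(2)\<close>,
       use Suc in \<open>auto\<close>)
qed

text \<open>Differentiation lowers the exponent, so the induction keeps \<open>b\<close> arbitrary.
  The exponent \<open>- 1/2\<close> is used later to normalise vector fields.\<close>

lemma Ck_on_powr:
  fixes f :: "'a::euclidean_space \<Rightarrow> real"
  assumes "open V" "Ck_on k V f" "\<And>x. x \<in> V \<Longrightarrow> 0 < f x"
  shows "Ck_on k V (\<lambda>x. f x powr b)"
  using assms(2)
proof (induction k arbitrary: b)
  case 0
  then show ?case using assms(3) by (auto intro!: continuous_on_powr continuous_on_const) (metis less_irrefl)
next
  case (Suc k)
  show ?case
  proof (rule Ck_on_SucI[OF assms(1)])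
    fix x assume x: "x \<in> V"
    show "((\<lambda>x. f x powr b) has_derivative
        (\<lambda>v. b *\<^sub>R (f x powr (b - 1) * frechet_derivative f (at x) v))) (at x)"
      using Ck_on_Suc_has_derivative[OF Suc.prems x] assms(3)[OF x]
      by (auto intro!: derivative_eq_intros ext simp: powr_diff)
  next
    show "Ck_on k V (\<lambda>x. b *\<^sub>R (f x powr (b - 1) * frechet_derivative f (at x) v))" for v
    proof -
      have "Ck_on k V (\<lambda>x. frechet_derivative f (at x) v)" using Suc.prems by simp
      with Suc.IH[OF Ck_on_SucD[OF Suc.prems], of "b - 1"] show ?thesis
        by (rule Ck_on_linear_compose[OF assms(1) bounded_linear_scaleR_right
              Ck_on_bilinear[OF assms(1) bounded_bilinear_mult]])
    qed
  qed
qed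

section \<open>Slices of functions of time and space\<close>

lemma open_slice:
  assumes "open W"
  shows "open {y. (t, y) \<in> W}" "open {s. (s, y) \<in> W}"
  using open_vimage[OF assms, of "Pair t"] open_vimage[OF assms, of "\<lambda>s. (s, y)"]
  by (simp_all add: vimage_def continuous_on_Pair)

lemma has_derivative_slice:
  assumes "(f has_derivative D) (at (t, y))"
  shows "((\<lambda>y. f (t, y)) has_derivative (\<lambda>v. D (0, v))) (at y)"
proof -
  have "((\<lambda>y. (t, y)) has_derivative (\<lambda>v. (0, v))) (at y)"
    by (auto intro!: has_derivative_Pair)
  then show ?thesis by (rule has_derivative_compose[where g=f and g'=D]) (rule assms)
qed

lemma has_vector_derivative_slice:
  assumes "(f has_derivative D) (at (t, y))"
  shows "((\<lambda>s. f (s, y)) has_vector_derivative D (1, 0)) (at (t::real))"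
proof -
  have "((\<lambda>s. (s, y)) has_derivative (\<lambda>c. (c, 0))) (at t)"
    by (auto intro!: has_derivative_Pair)
  then have "((\<lambda>s. f (s, y)) has_derivative (\<lambda>c. D (c, 0))) (at t)"
    by (rule has_derivative_compose[where g=f and g'=D]) (rule assms)
  moreover have "(\<lambda>c. D (c, 0)) = (\<lambda>c. c *\<^sub>R D (1, 0))"
    using linear_cmul[OF has_derivative_linear[OF assms], of _ "(1, 0)", symmetric] by simp
  ultimately show ?thesis by (simp only: has_vector_derivative_def)
qed

lemma Ck_on_slice:
  fixes f :: "real \<times> 'a::euclidean_space \<Rightarrow> 'b::real_normed_vector"
  assumes "open W" "Ck_on k W f"
  shows "Ck_on k {y. (t, y) \<in> W} (\<lambda>y. f (t, y))"
  using assms(2)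
proof (induction k arbitrary: f)
  case 0
  then show ?case
    by (auto intro!: continuous_on_compose2[of W f] continuous_intros)
next
  case (Suc k)
  show ?case
  proof (rule Ck_on_SucI[OF open_slice(1)[OF assms(1)]])
    fix y assume "y \<in> {y. (t, y) \<in> W}"
    then show "((\<lambda>y. f (t, y)) has_derivative (\<lambda>v. frechet_derivative f (at (t, y)) (0, v))) (at y)"
      by (intro has_derivative_slice Ck_on_Suc_has_derivative[OF Suc.prems]) simp
  qed (use Suc in auto)
qed

text \<open>Two applications of the mean value theorem express the second difference quotient in
  either order of differentiation.\<close>

lemma second_difference:
  fixes f :: "'a::euclidean_space \<Rightarrow> real"
  assumes f: "Ck_on 2 (ball x e) f" and h: "0 < h" "h * (norm v + norm w) < e"
  obtains z where "dist z x \<le> h * (norm v + norm w)"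
    "f (x + h *\<^sub>R v + h *\<^sub>R w) - f (x + h *\<^sub>R v) - f (x + h *\<^sub>R w) + f x =
       h\<^sup>2 * frechet_derivative (\<lambda>y. frechet_derivative f (at y) v) (at z) w"
proof -
  define z where "z s r = x + s *\<^sub>R v + r *\<^sub>R w" for s r
  have dz: "dist (z s r) x \<le> h * (norm v + norm w)" if "0 \<le> s" "s \<le> h" "0 \<le> r" "r \<le> h" for s r
  proof -
    have "norm (s *\<^sub>R v + r *\<^sub>R w) \<le> s * norm v + r * norm w"
      using norm_triangle_ineq[of "s *\<^sub>R v" "r *\<^sub>R w"] that by simp
    also have "\<dots> \<le> h * norm v + h * norm w"
      using that by (intro add_mono mult_right_mono) auto
    finally show ?thesis by (simp add: z_def dist_norm algebra_simps)
  qed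
  have zb: "z s r \<in> ball x e" if "0 \<le> s" "s \<le> h" "0 \<le> r" "r \<le> h" for s r
    using dz[OF that] h(2) by (simp add: dist_commute)
  let ?g = "\<lambda>y. frechet_derivative f (at y) v"
  note d1 = Ck_on_2_has_derivative(1)[OF f] and d2 = Ck_on_2_has_derivative(2)[OF f, where v=v]
  have zs: "((\<lambda>s. z s r) has_derivative (\<lambda>c. c *\<^sub>R v)) (at s)" for s r
    unfolding z_def by (auto intro!: derivative_eq_intros)
  have zr: "((\<lambda>r. z s r) has_derivative (\<lambda>c. c *\<^sub>R w)) (at r)" for s r
    unfolding z_def by (auto intro!: derivative_eq_intros)
  have lin1: "frechet_derivative f (at y) (c *\<^sub>R v) = c *\<^sub>R ?g y" if "y \<in> ball x e" for y c
    using linear_cmul[OF has_derivative_linear[OF d1[OF that]]] .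
  have lin2: "frechet_derivative ?g (at y) (c *\<^sub>R w) = c *\<^sub>R frechet_derivative ?g (at y) w"
    if "y \<in> ball x e" for y c
    using linear_cmul[OF has_derivative_linear[OF d2[OF that]]] .
  have "((\<lambda>s. f (z s h) - f (z s 0)) has_real_derivative ?g (z s h) - ?g (z s 0)) (at s)"
    if "0 \<le> s" "s \<le> h" for s
  proof -
    have a: "z s h \<in> ball x e" "z s 0 \<in> ball x e" using zb that h(1) by auto
    have "((\<lambda>s. f (z s h) - f (z s 0)) has_derivative
       (\<lambda>c. frechet_derivative f (at (z s h)) (c *\<^sub>R v) - frechet_derivative f (at (z s 0)) (c *\<^sub>R v))) (at s)"
      by (intro has_derivative_diff has_derivative_compose[OF zs d1] a)
    then show ?thesis
      unfolding has_field_derivative_def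
      by (rule has_derivative_eq_rhs) (simp only: lin1[OF a(1)] lin1[OF a(2)], auto simp: algebra_simps)
  qed
  from MVT2[OF h(1) this] obtain s where s: "0 < s" "s < h"
    and e1: "f (z h h) - f (z h 0) - (f (z 0 h) - f (z 0 0)) = h * (?g (z s h) - ?g (z s 0))"
    by auto
  have "((\<lambda>r. ?g (z s r)) has_real_derivative frechet_derivative ?g (at (z s r)) w) (at r)"
    if "0 \<le> r" "r \<le> h" for r
  proof -
    have a: "z s r \<in> ball x e" using zb that s by auto
    have "((\<lambda>r. ?g (z s r)) has_derivative (\<lambda>c. frechet_derivative ?g (at (z s r)) (c *\<^sub>R w))) (at r)"
      by (intro has_derivative_compose[OF zr d2] a)
    then show ?thesis
      unfolding has_field_derivative_def
      by (rule has_derivative_eq_rhs) (simp only: lin2[OF a], auto simp: algebra_simps)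
  qed
  from MVT2[OF h(1) this] obtain r where r: "0 < r" "r < h"
    and e2: "?g (z s h) - ?g (z s 0) = h * frechet_derivative ?g (at (z s r)) w"
    by auto
  show ?thesis
  proof (rule that[of "z s r"])
    show "dist (z s r) x \<le> h * (norm v + norm w)" using dz s r by auto
    show "f (x + h *\<^sub>R v + h *\<^sub>R w) - f (x + h *\<^sub>R v) - f (x + h *\<^sub>R w) + f x =
       h\<^sup>2 * frechet_derivative ?g (at (z s r)) w"
      using e1 unfolding e2 by (simp add: z_def power2_eq_square)
  qed
qed

text \<open>Exchanging \<open>v\<close> and \<open>w\<close> leaves the second difference unchanged,
  so the two mixed derivatives agree, though at two possibly different points \<open>z1\<close> and
  \<open>z2\<close>. Both points approach \<open>x\<close> as \<open>h\<close> shrinks, and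
  continuity of the mixed derivatives does the rest.\<close>

lemma second_derivative_symmetric_real:
  fixes f :: "'a::euclidean_space \<Rightarrow> real"
  assumes "open V" "x \<in> V" "Ck_on 2 V f"
  shows "frechet_derivative (\<lambda>y. frechet_derivative f (at y) v) (at x) w =
         frechet_derivative (\<lambda>y. frechet_derivative f (at y) w) (at x) v"
proof -
  let ?F = "\<lambda>v w y. frechet_derivative (\<lambda>y. frechet_derivative f (at y) v) (at y) w"
  obtain e where e: "e > 0" "ball x e \<subseteq> V" using assms(1,2) openE by blast
  have f: "Ck_on 2 (ball x e) f" using Ck_on_subset assms(3) e by blast
  have cont: "isCont (?F v w) x" for v w
  proof -
    have "continuous_on (ball x e) (?F v w)" using f by (simp add: numeral_2_eq_2)
    then show ?thesis using e(1) by (simp add: continuous_on_eq_continuous_at)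
  qed
  have "dist (?F v w x) (?F w v x) \<le> \<epsilon>" if \<epsilon>: "\<epsilon> > 0" for \<epsilon>
  proof -
    obtain d1 where d1: "d1 > 0" "\<And>y. dist y x < d1 \<Longrightarrow> dist (?F v w y) (?F v w x) < \<epsilon>/2"
      using cont[of v w] \<epsilon> unfolding continuous_at_eps_delta by (elim allE[of _ "\<epsilon>/2"]) auto
    obtain d2 where d2: "d2 > 0" "\<And>y. dist y x < d2 \<Longrightarrow> dist (?F w v y) (?F w v x) < \<epsilon>/2"
      using cont[of w v] \<epsilon> unfolding continuous_at_eps_delta by (elim allE[of _ "\<epsilon>/2"]) auto
    \<comment> \<open>The summand 1 keeps \<open>N\<close> positive if \<open>v\<close> and
      \<open>w\<close> vanish. The choice of \<open>h\<close> keeps the parallelogram inside the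
      ball and the mean value points inside both continuity radii.\<close>
    define N where "N = norm v + norm w + 1"
    have N: "N > 0" by (simp add: N_def add_nonneg_pos)
    define h where "h = min e (min d1 d2) / (2 * N)"
    have h: "h > 0" using e d1 d2 N by (simp add: h_def)
    have "h * (norm v + norm w) < h * (2 * N)"
      using h by (intro mult_strict_left_mono) (auto simp: N_def add_nonneg_pos intro: add_pos_nonneg add_strict_increasing)
    also have "\<dots> = min e (min d1 d2)" using N by (simp add: h_def)
    finally have hh: "h * (norm v + norm w) < min e (min d1 d2)" .
    obtain z1 where z1: "dist z1 x \<le> h * (norm v + norm w)"
      "f (x + h *\<^sub>R v + h *\<^sub>R w) - f (x + h *\<^sub>R v) - f (x + h *\<^sub>R w) + f x = h\<^sup>2 * ?F v w z1"
      using second_difference[OF f h, of v w] hh by (metis min_less_iff_conj)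
    obtain z2 where z2: "dist z2 x \<le> h * (norm w + norm v)"
      "f (x + h *\<^sub>R w + h *\<^sub>R v) - f (x + h *\<^sub>R w) - f (x + h *\<^sub>R v) + f x = h\<^sup>2 * ?F w v z2"
      using second_difference[OF f h, of w v] hh by (metis min_less_iff_conj add.commute)
    have "h\<^sup>2 * ?F v w z1 = h\<^sup>2 * ?F w v z2"
      using z1(2) z2(2) by (simp add: algebra_simps)
    then have "?F v w z1 = ?F w v z2" using h by simp
    moreover have "dist (?F v w z1) (?F v w x) < \<epsilon>/2" using d1(2) z1(1) hh by auto
    moreover have "dist (?F w v z2) (?F w v x) < \<epsilon>/2" using d2(2) z2(1) hh by (auto simp: add.commute)
    ultimately show ?thesis unfolding dist_real_def by linarith
  qed
  then show ?thesis
    by (metis dist_le_zero_iff dense_ge)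
qed

text \<open>The mean value theorem is a statement about real functions; vector values are handled by
  pairing with basis vectors.\<close>

lemma second_derivative_symmetric:
  fixes f :: "'a::euclidean_space \<Rightarrow> 'b::euclidean_space"
  assumes V: "open V" "x \<in> V" and f: "Ck_on 2 V f"
  shows "frechet_derivative (\<lambda>y. frechet_derivative f (at y) v) (at x) w =
         frechet_derivative (\<lambda>y. frechet_derivative f (at y) w) (at x) v"
proof (rule euclidean_eqI)
  fix b :: 'b assume "b \<in> Basis"
  have bl: "bounded_linear (\<lambda>z::'b. z \<bullet> b)" by (rule bounded_linear_inner_left)
  have fb: "Ck_on 2 V (\<lambda>y. f y \<bullet> b)" by (rule Ck_on_linear_compose[OF V(1) bl f])
  have 1: "frechet_derivative (\<lambda>y. f y \<bullet> b) (at y) v = frechet_derivative f (at y) v \<bullet> b"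
    if "y \<in> V" for y v
    using bounded_linear.has_derivative[OF bl Ck_on_2_has_derivative(1)[OF f that]]
    by (simp add: frechet_derivative_at[symmetric])
  have 2: "frechet_derivative (\<lambda>y. frechet_derivative (\<lambda>y. f y \<bullet> b) (at y) v) (at x) w =
      frechet_derivative (\<lambda>y. frechet_derivative f (at y) v) (at x) w \<bullet> b" for v w
  proof -
    have "((\<lambda>y. frechet_derivative f (at y) v \<bullet> b) has_derivative
        (\<lambda>w. frechet_derivative (\<lambda>y. frechet_derivative f (at y) v) (at x) w \<bullet> b)) (at x)"
      by (rule bounded_linear.has_derivative[OF bl Ck_on_2_has_derivative(2)[OF f V(2)]])
    then have "((\<lambda>y. frechet_derivative (\<lambda>y. f y \<bullet> b) (at y) v) has_derivative
        (\<lambda>w. frechet_derivative (\<lambda>y. frechet_derivative f (at y) v) (at x) w \<bullet> b)) (at x)"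
      by (rule has_derivative_transform_within_open[OF _ V]) (simp add: 1)
    then show ?thesis by (metis frechet_derivative_at)
  qed
  show "frechet_derivative (\<lambda>y. frechet_derivative f (at y) v) (at x) w \<bullet> b =
      frechet_derivative (\<lambda>y. frechet_derivative f (at y) w) (at x) v \<bullet> b"
    using second_derivative_symmetric_real[OF V fb, of v w] by (simp add: 2)
qed

section \<open>Derivatives within a set\<close>

text \<open>The bridge from an extension \<open>g\<close> on an open set to a function that matters
  on \<open>S\<close> only. Derivatives within the closure and derivatives along the boundary both
  start here.\<close>

lemma has_derivative_within_local_eq:
  assumes "open A" "x \<in> A" "x \<in> S" "\<And>y. y \<in> A \<inter> S \<Longrightarrow> f y = g y"
    and "(g has_derivative D) (at x)"
  shows "(f has_derivative D) (at x within S)"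
proof -
  obtain e where e: "e > 0" "ball x e \<subseteq> A" using assms(1,2) openE by blast
  show ?thesis
  proof (rule has_derivative_transform_within[OF has_derivative_at_withinI[OF assms(5)] e(1) assms(3)])
    fix y assume "y \<in> S" "dist y x < e"
    then have "y \<in> A \<inter> S" using e(2) by (auto simp: dist_commute)
    then show "g y = f y" using assms(4) by simp
  qed
qed

lemma has_derivative_along_curve:
  assumes "(f has_derivative D) (at x within S)" "\<gamma> 0 = x" "\<gamma> ` R \<subseteq> S"
    and "(\<gamma> has_vector_derivative v) (at 0 within R)"
  shows "((\<lambda>s. f (\<gamma> s)) has_vector_derivative D v) (at (0::real) within R)"
proof -
  have "(f has_derivative D) (at (\<gamma> 0) within \<gamma> ` R)"
    using assms(1-3) has_derivative_subset by blast
  with assms(4) have "((\<lambda>s. f (\<gamma> s)) has_derivative (\<lambda>c. D (c *\<^sub>R v))) (at 0 within R)"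
    unfolding has_vector_derivative_def by (rule has_derivative_in_compose)
  moreover have "D (c *\<^sub>R v) = c *\<^sub>R D v" for c
    using linear_cmul[OF has_derivative_linear[OF assms(1)]] .
  ultimately show ?thesis by (simp add: has_vector_derivative_def)
qed

text \<open>Composition with a curve reduces the claim to uniqueness of a derivative in one
  variable. The parameter set \<open>R\<close> will be an interval around 0 for vectors tangent to
  the boundary, and a half-open interval starting at 0 for directions entering the domain.\<close>

lemma derivative_within_unique_along_curve:
  assumes "(f has_derivative D) (at x within S)" "(f has_derivative D') (at x within S)"
    and "\<gamma> 0 = x" "\<gamma> ` R \<subseteq> S" "(\<gamma> has_vector_derivative v) (at (0::real) within R)"
    and "at 0 within R \<noteq> bot"
  shows "D v = D' v"
  using vector_derivative_unique_within[OF assms(6)] has_derivative_along_curve assms(1-5) by blast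

lemma derivative_within_unique_tangent:
  assumes "(f has_derivative D) (at x within M)" "(f has_derivative D') (at x within M)"
    and "v \<in> tangent_space M x"
  shows "D v = D' v"
proof -
  obtain \<gamma> \<epsilon> where \<gamma>: "0 < \<epsilon>" "\<gamma> 0 = x" "\<And>s::real. \<bar>s\<bar> < \<epsilon> \<Longrightarrow> \<gamma> s \<in> M"
    "(\<gamma> has_vector_derivative v) (at 0)"
    using assms(3) by (auto simp: tangent_space_def)
  have nb: "at (0::real) within {-\<epsilon><..<\<epsilon>} \<noteq> bot"
    using \<gamma>(1) by (subst at_within_open) auto
  have sub: "\<gamma> ` {-\<epsilon><..<\<epsilon>} \<subseteq> M" using \<gamma>(3) by auto
  show ?thesis
    by (rule derivative_within_unique_along_curve[OF assms(1,2) \<gamma>(2) sub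
          has_vector_derivative_at_within[OF \<gamma>(4)] nb])
qed

lemma surface_deriv_eq:
  assumes "(f has_derivative D) (at x within M)" "v \<in> tangent_space M x"
  shows "surface_deriv M f x v = D v"
proof -
  have "f differentiable (at x within M)" using assms(1) by (auto simp: differentiable_def)
  then show ?thesis
    unfolding surface_deriv_def frechet_derivative_works
    using derivative_within_unique_tangent assms by blast
qed

text \<open>At the final time the constraints hold for earlier times only, while the extension of
  the flow is differentiable from both sides. The left-hand difference quotients already determine
  the derivative.\<close>

lemma zero_one_sided_derivative:
  fixes f :: "real \<Rightarrow> 'a::real_normed_vector"
  assumes "(f has_vector_derivative D) (at t)" "0 < \<delta>"
    and "\<And>s. t - \<delta> < s \<Longrightarrow> s \<le> t \<Longrightarrow> f s = 0"
  shows "D = 0"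
proof -
  let ?R = "{t - \<delta><..t}"
  have "at t within ?R \<noteq> bot"
    using assms(2) by (simp add: trivial_limit_within)
  moreover have "(f has_vector_derivative D) (at t within ?R)"
    using assms(1) by (rule has_vector_derivative_at_within)
  moreover have "(f has_vector_derivative 0) (at t within ?R)"
    by (rule has_vector_derivative_transform[of t ?R f "\<lambda>_. 0"]) (use assms in auto)
  ultimately show ?thesis by (rule vector_derivative_unique_within)
qed

lemma linear_axis_expansion:
  fixes D :: "real^3 \<Rightarrow> 'b::real_vector"
  assumes "linear D"
  shows "D v = (\<Sum>i\<in>UNIV. (v $ i) *\<^sub>R D (axis i 1))"
proof -
  have "D v = D (\<Sum>i\<in>UNIV. (v $ i) *\<^sub>R axis i 1)"
    by (simp only: basis_expansion flip: scalar_mult_eq_scaleR)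
  then show ?thesis
    using assms by (simp add: linear_sum linear_cmul)
qed

lemma sum_axis_component: "(\<Sum>j\<in>UNIV. c j *\<^sub>R axis j 1 :: real^'n) $ i = c i"
  by (simp add: axis_def if_distrib cong: if_cong)

lemma grad_inner:
  assumes "(\<rho> has_derivative D) (at y)"
  shows "D v = grad UNIV \<rho> y \<bullet> v"
  using linear_axis_expansion[OF has_derivative_linear[OF assms], of v]
  by (simp add: grad_def partial_def inner_vec_def mult.commute flip: frechet_derivative_at[OF assms])

section \<open>Geometry of the boundary\<close>

locale smooth_domain =
  fixes \<Omega> :: "(real^3) set" and \<nu> :: "real^3 \<Rightarrow> real^3"
  assumes domain: "bounded_smooth_domain \<Omega>"
    and normal: "outward_unit_normal \<Omega> \<nu>"
begin

lemma open_\<Omega>: "open \<Omega>"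
  using domain by (simp add: bounded_smooth_domain_def)

section \<open>Defining functions near the boundary\<close>

definition boundary_chart :: "(real^3) set \<Rightarrow> (real^3 \<Rightarrow> real) \<Rightarrow> bool" where
  "boundary_chart V \<rho> \<longleftrightarrow> open V \<and> (\<forall>k. Ck_on k V \<rho>) \<and> (\<forall>y\<in>V. grad UNIV \<rho> y \<noteq> 0) \<and>
     \<Omega> \<inter> V = {y\<in>V. \<rho> y < 0}"

text \<open>On a smaller neighbourhood the defining function may be replaced by a single function
  that is of every class \<open>Ck_on k\<close> there. Its derivatives and its gradient are then
  ordinary ones, with no reference to a set.\<close>

lemma boundary_chart_exists:
  assumes "x \<in> frontier \<Omega>"
  obtains V \<rho> where "boundary_chart V \<rho>" "x \<in> V"
proof -
  obtain V \<rho> where V: "open V" "x \<in> V" "smooth_on V \<rho>" "\<forall>y\<in>V. grad V \<rho> y \<noteq> 0"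
    "\<Omega> \<inter> V = {y\<in>V. \<rho> y < 0}"
    using domain assms unfolding bounded_smooth_domain_def by blast
  obtain W g where W: "open W" "x \<in> W" "\<forall>k. Ck_on k W g" "\<forall>y\<in>W \<inter> V. g y = \<rho> y"
    using V(2,3) unfolding smooth_on_def by blast
  have grad_eq: "grad UNIV g y = grad V \<rho> y" if y: "y \<in> W \<inter> V" for y
  proof -
    have "Ck_on (Suc 0) W g" using W(3) by blast
    then have g: "g differentiable at y" using y by simp
    have "frechet_derivative g (at y) = frechet_derivative \<rho> (at y)"
      by (rule frechet_derivative_transform_within_open[OF g, of "W \<inter> V"]) (use V W y in auto)
    then show ?thesis
      using at_within_open[of y V] V(1) y by (simp add: grad_def partial_def)
  qed
  show ?thesis
  proof (rule that[of "W \<inter> V" g])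
    show "boundary_chart (W \<inter> V) g"
      using V W grad_eq Ck_on_subset[of _ W g "W \<inter> V"] unfolding boundary_chart_def by auto
  qed (use V W in auto)
qed

lemma boundary_chart_has_derivative:
  assumes "boundary_chart V \<rho>" "y \<in> V"
  shows "(\<rho> has_derivative (\<lambda>v. grad UNIV \<rho> y \<bullet> v)) (at y)"
proof -
  have "Ck_on (Suc 0) V \<rho>" using assms by (auto simp: boundary_chart_def)
  from Ck_on_Suc_has_derivative[OF this assms(2)] show ?thesis
    by (rule has_derivative_eq_rhs) (use grad_inner[OF Ck_on_Suc_has_derivative[OF \<open>Ck_on (Suc 0) V \<rho>\<close> assms(2)]] in blast)
qed

text \<open>As \<open>\<rho>\<close> vanishes at \<open>y\<close>, the sign of its derivative along
  the ray is its sign shortly after the start. The bound \<open>d0\<close> keeps the ray inside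
  \<open>V\<close>, where the sign of \<open>\<rho>\<close> decides membership in
  \<open>\<Omega>\<close>.\<close>

lemma boundary_chart_sign:
  assumes "boundary_chart V \<rho>" "y \<in> V" "\<rho> y = 0"
  shows "grad UNIV \<rho> y \<bullet> v < 0 \<Longrightarrow> \<exists>d>0. \<forall>s. 0 < s \<and> s < d \<longrightarrow> y + s *\<^sub>R v \<in> \<Omega>"
    and "0 < grad UNIV \<rho> y \<bullet> v \<Longrightarrow> \<exists>d>0. \<forall>s. 0 < s \<and> s < d \<longrightarrow> y + s *\<^sub>R v \<notin> \<Omega>"
proof -
  have oV: "open V" and \<Omega>V: "\<Omega> \<inter> V = {y\<in>V. \<rho> y < 0}" using assms(1) by (auto simp: boundary_chart_def)
  obtain e where e: "e > 0" "ball y e \<subseteq> V" using oV assms(2) openE by blast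
  define d0 where "d0 = e / (norm v + 1)"
  have d0: "d0 > 0" using e by (simp add: d0_def add_nonneg_pos)
  have inV: "y + s *\<^sub>R v \<in> V" if "0 < s" "s < d0" for s
  proof -
    have "s * norm v \<le> s * (norm v + 1)" using that by simp
    also have "\<dots> < e" using that by (simp add: d0_def pos_less_divide_eq add_nonneg_pos)
    finally show ?thesis using e(2) that by (auto simp: dist_norm)
  qed
  have "((\<lambda>s. \<rho> (y + s *\<^sub>R v)) has_derivative (\<lambda>c. grad UNIV \<rho> y \<bullet> (c *\<^sub>R v))) (at 0)"
    by (rule has_derivative_compose[of "\<lambda>s. y + s *\<^sub>R v" "\<lambda>c. c *\<^sub>R v" 0 UNIV \<rho>, simplified])
      (use boundary_chart_has_derivative[OF assms(1,2)] in \<open>auto intro!: derivative_eq_intros\<close>)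
  then have der: "((\<lambda>s. \<rho> (y + s *\<^sub>R v)) has_real_derivative grad UNIV \<rho> y \<bullet> v) (at 0)"
    unfolding has_field_derivative_def by (rule has_derivative_eq_rhs) auto
  show "\<exists>d>0. \<forall>s. 0 < s \<and> s < d \<longrightarrow> y + s *\<^sub>R v \<in> \<Omega>" if neg: "grad UNIV \<rho> y \<bullet> v < 0"
  proof -
    obtain d where d: "d > 0" "\<forall>h>0. h < d \<longrightarrow> \<rho> (y + 0 *\<^sub>R v) > \<rho> (y + (0 + h) *\<^sub>R v)"
      using DERIV_neg_dec_right[OF der neg] by blast
    then have "y + s *\<^sub>R v \<in> \<Omega>" if "0 < s" "s < min d d0" for s
      using inV[of s] that assms(3) \<Omega>V by auto
    then show ?thesis using d(1) d0 by (intro exI[of _ "min d d0"]) auto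
  qed
  show "\<exists>d>0. \<forall>s. 0 < s \<and> s < d \<longrightarrow> y + s *\<^sub>R v \<notin> \<Omega>" if pos: "0 < grad UNIV \<rho> y \<bullet> v"
  proof -
    obtain d where d: "d > 0" "\<forall>h>0. h < d \<longrightarrow> \<rho> (y + 0 *\<^sub>R v) < \<rho> (y + (0 + h) *\<^sub>R v)"
      using DERIV_pos_inc_right[OF der pos] by blast
    have "y + s *\<^sub>R v \<notin> \<Omega>" if "0 < s" "s < min d d0" for s
    proof
      assume "y + s *\<^sub>R v \<in> \<Omega>"
      then have "\<rho> (y + s *\<^sub>R v) < 0" using inV[of s] that \<Omega>V by auto
      then show False using d(2) that assms(3) by auto
    qed
    then show ?thesis using d(1) d0 by (intro exI[of _ "min d d0"]) auto
  qed
qed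

text \<open>The points with positive \<open>\<rho>\<close> form an open set that misses
  \<open>\<Omega>\<close>, hence also its closure. Conversely, stepping from a zero of
  \<open>\<rho>\<close> against the nonzero gradient leads into \<open>\<Omega>\<close>, so the zero
  is a limit of points of \<open>\<Omega>\<close>.\<close>

lemma frontier_in_chart:
  assumes "boundary_chart V \<rho>" "y \<in> V"
  shows "y \<in> frontier \<Omega> \<longleftrightarrow> \<rho> y = 0"
proof
  have oV: "open V" and \<Omega>V: "\<Omega> \<inter> V = {y\<in>V. \<rho> y < 0}" using assms(1) by (auto simp: boundary_chart_def)
  have "continuous_on V \<rho>" using assms(1) unfolding boundary_chart_def by (metis Ck_on.simps(1))
  then have o: "open {z\<in>V. 0 < \<rho> z}"
    using continuous_open_preimage[OF _ oV open_greaterThan[of "0::real"]]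
    by (simp add: vimage_def Int_def conj_commute)
  {
    assume y: "y \<in> frontier \<Omega>"
    then have "y \<notin> \<Omega>" "y \<in> closure \<Omega>" using open_\<Omega> by (auto simp: frontier_def interior_open)
    then have "\<not> \<rho> y < 0" using \<Omega>V assms(2) by auto
    moreover have "\<not> 0 < \<rho> y"
    proof
      assume "0 < \<rho> y"
      then have "y \<in> {z\<in>V. 0 < \<rho> z} \<inter> closure \<Omega>" using assms(2) \<open>y \<in> closure \<Omega>\<close> by auto
      then have "{z\<in>V. 0 < \<rho> z} \<inter> \<Omega> \<noteq> {}"
        using open_Int_closure_eq_empty[OF o] by auto
      then show False using \<Omega>V by force
    qed
    ultimately show "\<rho> y = 0" by simp
  }
  assume y: "\<rho> y = 0"
  then have n: "y \<notin> \<Omega>" using \<Omega>V assms(2) by force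
  have "grad UNIV \<rho> y \<noteq> 0" using assms by (auto simp: boundary_chart_def)
  then have "grad UNIV \<rho> y \<bullet> (- grad UNIV \<rho> y) < 0" by simp
  then obtain d where d: "d > 0" "\<And>s. 0 < s \<Longrightarrow> s < d \<Longrightarrow> y + s *\<^sub>R (- grad UNIV \<rho> y) \<in> \<Omega>"
    using boundary_chart_sign(1)[OF assms y] by blast
  have "((\<lambda>s. y + s *\<^sub>R (- grad UNIV \<rho> y)) \<longlongrightarrow> y + 0 *\<^sub>R (- grad UNIV \<rho> y)) (at_right 0)"
    by (intro tendsto_intros)
  moreover have "eventually (\<lambda>s. y + s *\<^sub>R (- grad UNIV \<rho> y) \<in> closure \<Omega>) (at_right 0)"
    using d closure_subset by (intro eventually_at_rightI[of 0 d]) auto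
  ultimately have "y \<in> closure \<Omega>"
    using Lim_in_closed_set[OF closed_closure] trivial_limit_at_right_real by force
  then show "y \<in> frontier \<Omega>" using n open_\<Omega> by (simp add: frontier_def interior_open)
qed

text \<open>A curve on the boundary in a prescribed tangent direction is obtained from the straight line
  by taking nearest points of the boundary: the sign change of the defining function shows that
  the distance is \<open>o(s)\<close>, so no implicit function theorem is needed.\<close>

lemma frontier_near_tangent:
  assumes "boundary_chart V \<rho>" "x \<in> V" "x \<in> frontier \<Omega>" "grad UNIV \<rho> x \<bullet> v = 0" "0 < \<epsilon>"
  shows "\<exists>d>0. \<forall>s. \<bar>s\<bar> < d \<longrightarrow> (\<exists>q\<in>frontier \<Omega>. dist (x + s *\<^sub>R v) q \<le> \<epsilon> * \<bar>s\<bar>)"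
proof -
  \<comment> \<open>Since \<open>n\<close> has length \<open>\<epsilon>\<close>, the points
    \<open>x + s *\<^sub>R (w - n)\<close> and \<open>x + s *\<^sub>R (w + n)\<close> lie in the
    ball of radius \<open>\<epsilon> * s\<close> around \<open>x + s *\<^sub>R w\<close>, the first
    inside \<open>\<Omega>\<close> and the second outside. The ball is connected, so it meets the
    boundary.\<close>
  define n where "n = (\<epsilon> / norm (grad UNIV \<rho> x)) *\<^sub>R grad UNIV \<rho> x"
  have g: "grad UNIV \<rho> x \<noteq> 0" using assms by (auto simp: boundary_chart_def)
  have gn: "grad UNIV \<rho> x \<bullet> n > 0" using g assms(5) by (simp add: n_def)
  have nn: "norm n = \<epsilon>" using g assms(5) by (simp add: n_def)
  have \<rho>: "\<rho> x = 0" using frontier_in_chart assms by blast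
  \<comment> \<open>Only positive parameters are treated; negative ones follow by reversing the
    direction.\<close>
  have ev: "\<exists>d>0. \<forall>s. 0 < s \<and> s < d \<longrightarrow>
      (\<exists>q\<in>frontier \<Omega>. dist (x + s *\<^sub>R w) q \<le> \<epsilon> * s)" if w: "grad UNIV \<rho> x \<bullet> w = 0" for w
  proof -
    obtain d1 where d1: "d1 > 0" "\<forall>s. 0 < s \<and> s < d1 \<longrightarrow> x + s *\<^sub>R (w - n) \<in> \<Omega>"
      using boundary_chart_sign(1)[OF assms(1,2) \<rho>, of "w - n"] gn w by (auto simp: inner_diff_right)
    obtain d2 where d2: "d2 > 0" "\<forall>s. 0 < s \<and> s < d2 \<longrightarrow> x + s *\<^sub>R (w + n) \<notin> \<Omega>"
      using boundary_chart_sign(2)[OF assms(1,2) \<rho>, of "w + n"] gn w by (auto simp: inner_add_right)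
    have "\<exists>q\<in>frontier \<Omega>. dist (x + s *\<^sub>R w) q \<le> \<epsilon> * s" if s: "0 < s" "s < min d1 d2" for s
    proof -
      let ?C = "cball (x + s *\<^sub>R w) (\<epsilon> * s)"
      have "x + s *\<^sub>R (w - n) \<in> ?C \<inter> \<Omega>" "x + s *\<^sub>R (w + n) \<in> ?C - \<Omega>"
        using d1 d2 s nn by (auto simp: dist_norm algebra_simps)
      then have "?C \<inter> frontier \<Omega> \<noteq> {}"
        by (intro connected_Int_frontier convex_connected convex_cball) blast+
      then show ?thesis by auto
    qed
    then show ?thesis using d1 d2 by (intro exI[of _ "min d1 d2"]) auto
  qed
  obtain d1 where d1: "d1 > 0" "\<And>s. 0 < s \<Longrightarrow> s < d1 \<Longrightarrow>
      \<exists>q\<in>frontier \<Omega>. dist (x + s *\<^sub>R v) q \<le> \<epsilon> * s"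
    using ev[OF assms(4)] by blast
  obtain d2 where d2: "d2 > 0" "\<And>s. 0 < s \<Longrightarrow> s < d2 \<Longrightarrow>
      \<exists>q\<in>frontier \<Omega>. dist (x + s *\<^sub>R (- v)) q \<le> \<epsilon> * s"
    using ev[of "- v"] assms(4) by auto
  have "\<exists>q\<in>frontier \<Omega>. dist (x + s *\<^sub>R v) q \<le> \<epsilon> * \<bar>s\<bar>" if s: "\<bar>s\<bar> < min d1 d2" for s
  proof -
    consider "s = 0" | "s > 0" | "s < 0" by linarith
    then show ?thesis
    proof cases
      case 1 then show ?thesis using assms(3) by (intro bexI[of _ x]) auto
    next
      case 2 then show ?thesis using d1(2)[of s] s by auto
    next
      case 3 then show ?thesis using d2(2)[of "- s"] s by auto
    qed
  qed
  then show ?thesis using d1 d2 by (intro exI[of _ "min d1 d2"]) auto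
qed

text \<open>Along the boundary \<open>\<rho>\<close> is constantly zero, so both 0 and the gradient
  represent its derivative there, and these agree on tangent vectors. The converse has to produce a
  curve.\<close>

lemma tangent_space_chart:
  assumes c: "boundary_chart V \<rho>" and x: "x \<in> V" "x \<in> frontier \<Omega>"
  shows "v \<in> tangent_space (frontier \<Omega>) x \<longleftrightarrow> grad UNIV \<rho> x \<bullet> v = 0"
proof
  assume "v \<in> tangent_space (frontier \<Omega>) x"
  have oV: "open V" using c by (auto simp: boundary_chart_def)
  have "(\<rho> has_derivative (\<lambda>_. 0)) (at x within frontier \<Omega>)"
    by (rule has_derivative_within_local_eq[OF oV x, of \<rho> "\<lambda>_. 0"])
      (use frontier_in_chart[OF c] in auto)
  moreover have "(\<rho> has_derivative (\<lambda>v. grad UNIV \<rho> x \<bullet> v)) (at x within frontier \<Omega>)"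
    by (rule has_derivative_at_withinI[OF boundary_chart_has_derivative[OF c x(1)]])
  ultimately show "grad UNIV \<rho> x \<bullet> v = 0"
    using derivative_within_unique_tangent \<open>v \<in> tangent_space (frontier \<Omega>) x\<close> by metis
next
  assume v: "grad UNIV \<rho> x \<bullet> v = 0"
  \<comment> \<open>\<open>tangent_space\<close> asks for a derivative at 0 alone. The nearest
    points have one there, even if \<open>closest_point\<close> selects them irregularly
    elsewhere.\<close>
  let ?\<gamma> = "\<lambda>s. closest_point (frontier \<Omega>) (x + s *\<^sub>R v)"
  have cl: "closed (frontier \<Omega>)" "frontier \<Omega> \<noteq> {}" using x by auto
  have 0: "?\<gamma> 0 = x" using x by (simp add: closest_point_self)
  have "(?\<gamma> has_derivative (\<lambda>s. s *\<^sub>R v)) (at 0)"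
    unfolding has_derivative_at_alt
  proof (intro conjI allI impI)
    show "bounded_linear (\<lambda>s. s *\<^sub>R v)" by (rule bounded_linear_scaleR_left)
    fix e :: real assume "0 < e"
    then obtain d where d: "d > 0"
      "\<And>s. \<bar>s\<bar> < d \<Longrightarrow> \<exists>q\<in>frontier \<Omega>. dist (x + s *\<^sub>R v) q \<le> e * \<bar>s\<bar>"
      using frontier_near_tangent[OF c x v] by meson
    have "norm (?\<gamma> s - ?\<gamma> 0 - (s - 0) *\<^sub>R v) \<le> e * norm (s - 0)" if s: "norm (s - 0) < d" for s
    proof -
      obtain q where "q \<in> frontier \<Omega>" "dist (x + s *\<^sub>R v) q \<le> e * \<bar>s\<bar>" using d(2)[of s] s by auto
      then have "dist (x + s *\<^sub>R v) (?\<gamma> s) \<le> e * \<bar>s\<bar>"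
        using closest_point_le[OF cl(1)] order_trans by blast
      then show ?thesis unfolding 0 by (simp add: dist_norm norm_minus_commute algebra_simps)
    qed
    then show "\<exists>d>0. \<forall>s. norm (s - 0) < d \<longrightarrow> norm (?\<gamma> s - ?\<gamma> 0 - (s - 0) *\<^sub>R v) \<le> e * norm (s - 0)"
      using d(1) by blast
  qed
  then show "v \<in> tangent_space (frontier \<Omega>) x"
    unfolding tangent_space_def mem_Collect_eq has_vector_derivative_def
    using 0 closest_point_in_set[OF cl] by (intro exI[of _ ?\<gamma>] exI[of _ 1]) auto
qed

section \<open>The unit normal and its extension off the boundary\<close>

lemma norm_normal: "x \<in> frontier \<Omega> \<Longrightarrow> norm (\<nu> x) = 1"
  using normal by (simp add: outward_unit_normal_def)

text \<open>The normal is orthogonal to everything that is orthogonal to the gradient, hence a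
  multiple of it. A negative factor would make the outward ray enter
  \<open>\<Omega>\<close>.\<close>

lemma normal_chart:
  assumes c: "boundary_chart V \<rho>" and x: "x \<in> V" "x \<in> frontier \<Omega>"
  shows "grad UNIV \<rho> x = norm (grad UNIV \<rho> x) *\<^sub>R \<nu> x"
proof -
  define n where "n = grad UNIV \<rho> x"
  have n: "n \<noteq> 0" using c x by (auto simp: boundary_chart_def n_def)
  have \<rho>: "\<rho> x = 0" using frontier_in_chart c x by blast
  have orth: "v \<bullet> \<nu> x = 0" if "n \<bullet> v = 0" for v
    using normal x tangent_space_chart[OF c x] that by (auto simp: outward_unit_normal_def n_def)
  \<comment> \<open>\<open>k\<close> is the coefficient of the projection of the normal onto
    \<open>n\<close>, and \<open>v\<close> is the remainder. It is orthogonal to \<open>n\<close>,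
    thus tangent, thus orthogonal to the normal and therefore to itself.\<close>
  define k where "k = (\<nu> x \<bullet> n) / (n \<bullet> n)"
  define v where "v = \<nu> x - k *\<^sub>R n"
  have nv: "n \<bullet> v = 0" using n by (simp add: v_def k_def inner_diff_right inner_commute)
  have "v \<bullet> v = v \<bullet> \<nu> x - k * (n \<bullet> v)"
    by (subst (2) v_def) (simp only: inner_diff_right inner_scaleR_right inner_commute[of n v])
  then have "v = 0" using orth[OF nv] nv by simp
  then have \<nu>: "\<nu> x = k *\<^sub>R n" by (simp add: v_def)
  have k1: "\<bar>k\<bar> * norm n = 1" using norm_normal[OF x(2)] \<nu> by simp
  have "k > 0"
  proof (rule ccontr)
    assume "\<not> k > 0"
    moreover have "k \<noteq> 0" using k1 by auto
    ultimately have "n \<bullet> \<nu> x < 0" using n \<nu> by (simp add: mult_less_0_iff)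
    then obtain d where d: "d > 0" "\<forall>s. 0 < s \<and> s < d \<longrightarrow> x + s *\<^sub>R \<nu> x \<in> \<Omega>"
      using boundary_chart_sign(1)[OF c x(1) \<rho>, of "\<nu> x"] by (auto simp: n_def)
    obtain \<epsilon> where \<epsilon>: "\<epsilon> > 0" "\<forall>s. 0 < s \<and> s < \<epsilon> \<longrightarrow> x + s *\<^sub>R \<nu> x \<notin> closure \<Omega>"
      using normal x by (auto simp: outward_unit_normal_def)
    have "x + (min d \<epsilon> / 2) *\<^sub>R \<nu> x \<in> \<Omega> - closure \<Omega>" using d \<epsilon> by auto
    then show False using closure_subset by auto
  qed
  then have "norm n * k = 1" using k1 by (simp add: mult.commute)
  then show ?thesis using \<nu> by (simp flip: n_def)
qed

lemma tangent_space_iff: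
  assumes "x \<in> frontier \<Omega>"
  shows "v \<in> tangent_space (frontier \<Omega>) x \<longleftrightarrow> v \<bullet> \<nu> x = 0"
proof -
  obtain V \<rho> where c: "boundary_chart V \<rho>" "x \<in> V" using boundary_chart_exists[OF assms] .
  have "grad UNIV \<rho> x \<noteq> 0" using c by (auto simp: boundary_chart_def)
  then have "grad UNIV \<rho> x \<bullet> v = 0 \<longleftrightarrow> v \<bullet> \<nu> x = 0"
    by (subst normal_chart[OF c assms]) (simp add: inner_commute)
  then show ?thesis using tangent_space_chart[OF c assms] by simp
qed

text \<open>The extension is the normalised gradient of a defining function. In its derivative the
  term from the normalising factor is normal to the surface, so on tangent vectors only a multiple
  of the Hessian remains. Hence the last property, which is the symmetry of the second fundamental
  form.\<close>

lemma normal_extension: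
  assumes "x \<in> frontier \<Omega>"
  obtains V N where "open V" "x \<in> V" "\<And>k. Ck_on k V N" "\<And>y. y \<in> V \<inter> frontier \<Omega> \<Longrightarrow> \<nu> y = N y"
    "\<And>v w. v \<bullet> \<nu> x = 0 \<Longrightarrow> w \<bullet> \<nu> x = 0 \<Longrightarrow>
       frechet_derivative N (at x) v \<bullet> w = frechet_derivative N (at x) w \<bullet> v"
proof -
  obtain V \<rho> where c: "boundary_chart V \<rho>" "x \<in> V" using boundary_chart_exists[OF assms] .
  have oV: "open V" and \<rho>: "\<And>k. Ck_on k V \<rho>" and gn: "\<And>y. y \<in> V \<Longrightarrow> grad UNIV \<rho> y \<noteq> 0"
    using c by (auto simp: boundary_chart_def)
  let ?g = "grad UNIV \<rho>"
  \<comment> \<open>\<open>r\<close> is the reciprocal of the length of the gradient, written as a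
    power so that \<open>Ck_on_powr\<close> applies.\<close>
  define r where "r y = (?g y \<bullet> ?g y) powr (- 1/2)" for y
  define N where "N y = r y *\<^sub>R ?g y" for y
  have gsum: "?g = (\<lambda>y. \<Sum>i\<in>UNIV. frechet_derivative \<rho> (at y) (axis i 1) *\<^sub>R axis i 1)"
    by (auto simp: grad_def partial_def vec_eq_iff axis_def if_distrib cong: if_cong)
  have "Ck_on k V (\<lambda>y. frechet_derivative \<rho> (at y) v)" for k v
    using \<rho>[of "Suc k"] by simp
  then have Ckg: "Ck_on k V ?g" for k
    unfolding gsum by (intro Ck_on_sum[OF oV] Ck_on_linear_compose[OF oV bounded_linear_scaleR_left]) blast
  have Ckr: "Ck_on k V r" for k
    unfolding r_def using gn
    by (intro Ck_on_powr[OF oV] Ck_on_bilinear[OF oV bounded_bilinear_inner] Ckg) simp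
  have CkN: "Ck_on k V N" for k
    unfolding N_def by (intro Ck_on_bilinear[OF oV bounded_bilinear_scaleR] Ckg Ckr)
  have eq: "\<nu> y = N y" if y: "y \<in> V \<inter> frontier \<Omega>" for y
  proof -
    have "r y * norm (?g y) = 1"
      using gn[of y] y by (simp add: r_def powr_minus powr_half_sqrt norm_eq_sqrt_inner)
    then show ?thesis
      unfolding N_def using normal_chart[OF c(1), of y] y by (metis IntD1 IntD2 scaleR_scaleR scaleR_one)
  qed
  have Dg: "(?g has_derivative frechet_derivative ?g (at x)) (at x)"
    using Ck_on_Suc_has_derivative[OF Ckg c(2)] .
  have hess: "frechet_derivative ?g (at x) v \<bullet> w =
      frechet_derivative (\<lambda>y. frechet_derivative \<rho> (at y) w) (at x) v" for v w
  proof -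
    have "((\<lambda>y. ?g y \<bullet> w) has_derivative (\<lambda>v. frechet_derivative ?g (at x) v \<bullet> w)) (at x)"
      by (rule bounded_linear.has_derivative[OF bounded_linear_inner_left Dg])
    then have "((\<lambda>y. frechet_derivative \<rho> (at y) w) has_derivative
        (\<lambda>v. frechet_derivative ?g (at x) v \<bullet> w)) (at x)"
      by (rule has_derivative_transform_within_open[OF _ oV c(2)])
        (use grad_inner Ck_on_Suc_has_derivative[OF \<rho>] in metis)
    then show ?thesis by (simp flip: frechet_derivative_at)
  qed
  have DN: "frechet_derivative N (at x) v \<bullet> w = r x * (frechet_derivative ?g (at x) v \<bullet> w)"
    if "w \<bullet> \<nu> x = 0" for v w
  proof -
    have "(N has_derivative (\<lambda>v. r x *\<^sub>R frechet_derivative ?g (at x) v +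
        frechet_derivative r (at x) v *\<^sub>R ?g x)) (at x)"
      unfolding N_def by (rule has_derivative_scaleR[OF Ck_on_Suc_has_derivative[OF Ckr c(2)] Dg])
    moreover have "?g x \<bullet> w = 0"
      using that normal_chart[OF c assms] by (metis inner_scaleR_left inner_commute mult_zero_right)
    ultimately show ?thesis by (simp add: inner_add_left flip: frechet_derivative_at)
  qed
  show ?thesis
  proof (rule that[OF oV c(2) CkN eq])
    fix v w assume "v \<bullet> \<nu> x = 0" "w \<bullet> \<nu> x = 0"
    then show "frechet_derivative N (at x) v \<bullet> w = frechet_derivative N (at x) w \<bullet> v"
      using second_derivative_symmetric[OF oV c(2) \<rho>, of v w] by (simp add: DN hess)
  qed
qed

text \<open>At a boundary point the rays with \<open>n \<bullet> v < 0\<close> enter the domain, and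
  along each of them the derivative is determined. These directions form an open half-space, which
  spans the whole space, so linearity finishes the proof.\<close>

lemma derivative_within_closure_unique:
  assumes x: "x \<in> closure \<Omega>" and D: "(f has_derivative D) (at x within closure \<Omega>)"
    "(f has_derivative D') (at x within closure \<Omega>)"
  shows "D = D'"
proof -
  have dir: "D v = D' v" if v: "\<exists>d>0. \<forall>s. 0 < s \<and> s < d \<longrightarrow> x + s *\<^sub>R v \<in> \<Omega>" for v
  proof -
    obtain d where d: "d > 0" "\<And>s. 0 < s \<Longrightarrow> s < d \<Longrightarrow> x + s *\<^sub>R v \<in> \<Omega>" using v by blast
    have "x + s *\<^sub>R v \<in> closure \<Omega>" if "s \<in> {0..<d}" for s
      using that d(2)[of s] x closure_subset by (cases "s = 0") auto
    moreover have "at 0 within {0..<d} \<noteq> bot"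
      using d(1) by (simp add: trivial_limit_within)
    moreover have "((\<lambda>s. x + s *\<^sub>R v) has_vector_derivative v) (at 0 within {0..<d})"
      unfolding has_vector_derivative_def by (auto intro!: derivative_eq_intros)
    ultimately show ?thesis
      by (intro derivative_within_unique_along_curve[OF D, of "\<lambda>s. x + s *\<^sub>R v" "{0..<d}"]) auto
  qed
  show ?thesis
  proof (cases "x \<in> \<Omega>")
    case True
    then have "at x within closure \<Omega> = at x"
      using open_\<Omega> closure_subset interior_maximal by (intro at_within_interior) blast
    then show ?thesis using D has_derivative_unique by metis
  next
    case False
    then have xf: "x \<in> frontier \<Omega>" using x open_\<Omega> by (simp add: frontier_def interior_open)
    obtain V \<rho> where c: "boundary_chart V \<rho>" "x \<in> V" using boundary_chart_exists[OF xf] .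
    define n where "n = grad UNIV \<rho> x"
    have n: "n \<bullet> n > 0" using c by (auto simp: boundary_chart_def n_def)
    have \<rho>: "\<rho> x = 0" using frontier_in_chart c xf by blast
    have neg: "D v = D' v" if "n \<bullet> v < 0" for v
      using dir boundary_chart_sign(1)[OF c \<rho>] that by (simp add: n_def)
    have lin: "linear D" "linear D'" using D has_derivative_linear by auto
    show ?thesis
    proof
      fix w
      \<comment> \<open>Large enough that \<open>w - k *\<^sub>R n\<close> points into the domain.
        As \<open>- n\<close> does so too, \<open>w\<close> is a combination of two inward
        directions.\<close>
      define k where "k = \<bar>n \<bullet> w\<bar> / (n \<bullet> n) + 1"
      have k: "k > 0" using n by (simp add: k_def add_nonneg_pos)
      have kn: "k * (n \<bullet> n) = \<bar>n \<bullet> w\<bar> + n \<bullet> n" using n by (simp add: k_def field_simps)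
      have "n \<bullet> (w - k *\<^sub>R n) = n \<bullet> w - k * (n \<bullet> n)" by (simp add: inner_diff_right)
      also have "\<dots> < 0" using n kn abs_ge_self[of "n \<bullet> w"] by linarith
      finally have "D (w - k *\<^sub>R n) = D' (w - k *\<^sub>R n)" by (rule neg)
      moreover have "D (- n) = D' (- n)" using n by (intro neg) simp
      ultimately show "D w = D' w"
        using lin by (simp add: linear_diff linear_cmul linear_neg)
    qed
  qed
qed

lemma frechet_derivative_closure:
  assumes "open A" "x \<in> A" "x \<in> closure \<Omega>" "\<And>y. y \<in> A \<inter> closure \<Omega> \<Longrightarrow> f y = g y"
    and "(g has_derivative D) (at x)"
  shows "frechet_derivative f (at x within closure \<Omega>) = D"
proof -
  have f: "(f has_derivative D) (at x within closure \<Omega>)"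
    by (rule has_derivative_within_local_eq[OF assms])
  then have "f differentiable (at x within closure \<Omega>)" by (auto simp: differentiable_def)
  then show ?thesis
    using f derivative_within_closure_unique[OF assms(3)] frechet_derivative_works by blast
qed

end

section \<open>Smooth functions on arbitrary sets\<close>

lemma smooth_onE:
  assumes "smooth_on S f" "x \<in> S"
  obtains V g where "open V" "x \<in> V" "\<And>k. Ck_on k V g" "\<And>y. y \<in> V \<inter> S \<Longrightarrow> f y = g y"
  using assms unfolding smooth_on_def by metis

lemma smooth_onI:
  assumes "\<And>x. x \<in> S \<Longrightarrow> \<exists>V g. open V \<and> x \<in> V \<and> (\<forall>k. Ck_on k V g) \<and> (\<forall>y\<in>V \<inter> S. f y = g y)"
  shows "smooth_on S f"
  using assms unfolding smooth_on_def by metis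

lemma smooth_on_subset: "smooth_on S f \<Longrightarrow> T \<subseteq> S \<Longrightarrow> smooth_on T f"
  by (rule smooth_onI, erule smooth_onE) blast+

lemma smooth_on_eq: "smooth_on M f \<Longrightarrow> (\<And>y. y \<in> M \<Longrightarrow> g y = f y) \<Longrightarrow> smooth_on M g"
  unfolding smooth_on_def by simp

lemma smooth_on_bilinear:
  assumes "bounded_bilinear B" "smooth_on S f" "smooth_on S g"
  shows "smooth_on S (\<lambda>x. B (f x) (g x))"
proof (rule smooth_onI)
  fix x assume x: "x \<in> S"
  obtain V f' where V: "open V" "x \<in> V" "\<And>k. Ck_on k V f'" "\<And>y. y \<in> V \<inter> S \<Longrightarrow> f y = f' y"
    using smooth_onE[OF assms(2) x] by blast
  obtain W g' where W: "open W" "x \<in> W" "\<And>k. Ck_on k W g'" "\<And>y. y \<in> W \<inter> S \<Longrightarrow> g y = g' y"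
    using smooth_onE[OF assms(3) x] by blast
  have "Ck_on k (V \<inter> W) (\<lambda>x. B (f' x) (g' x))" for k
    using V W by (intro Ck_on_bilinear[OF _ assms(1)]) (auto intro: Ck_on_subset)
  then show "\<exists>V h. open V \<and> x \<in> V \<and> (\<forall>k. Ck_on k V h) \<and> (\<forall>y\<in>V \<inter> S. B (f y) (g y) = h y)"
    using V W by (intro exI[of _ "V \<inter> W"] exI[of _ "\<lambda>x. B (f' x) (g' x)"]) auto
qed

lemma smooth_on_linear_compose:
  assumes "bounded_linear L" "smooth_on S f"
  shows "smooth_on S (\<lambda>x. L (f x))"
proof (rule smooth_onI)
  fix x assume x: "x \<in> S"
  obtain V g where V: "open V" "x \<in> V" "\<And>k. Ck_on k V g" "\<And>y. y \<in> V \<inter> S \<Longrightarrow> f y = g y"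
    using smooth_onE[OF assms(2) x] by blast
  then show "\<exists>V h. open V \<and> x \<in> V \<and> (\<forall>k. Ck_on k V h) \<and> (\<forall>y\<in>V \<inter> S. L (f y) = h y)"
    using Ck_on_linear_compose[OF V(1) assms(1) V(3)]
    by (intro exI[of _ V] exI[of _ "\<lambda>x. L (g x)"]) auto
qed

lemma smooth_on_add:
  assumes "smooth_on S f" "smooth_on S g"
  shows "smooth_on S (\<lambda>x. f x + g x)"
proof (rule smooth_onI)
  fix x assume x: "x \<in> S"
  obtain V f' where V: "open V" "x \<in> V" "\<And>k. Ck_on k V f'" "\<And>y. y \<in> V \<inter> S \<Longrightarrow> f y = f' y"
    using smooth_onE[OF assms(1) x] by blast
  obtain W g' where W: "open W" "x \<in> W" "\<And>k. Ck_on k W g'" "\<And>y. y \<in> W \<inter> S \<Longrightarrow> g y = g' y"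
    using smooth_onE[OF assms(2) x] by blast
  have "Ck_on k (V \<inter> W) (\<lambda>x. f' x + g' x)" for k
    using V W by (intro Ck_on_add) (auto intro: Ck_on_subset)
  then show "\<exists>V h. open V \<and> x \<in> V \<and> (\<forall>k. Ck_on k V h) \<and> (\<forall>y\<in>V \<inter> S. f y + g y = h y)"
    using V W by (intro exI[of _ "V \<inter> W"] exI[of _ "\<lambda>x. f' x + g' x"]) auto
qed

lemma smooth_on_const: "smooth_on S (\<lambda>x. c)"
  by (rule smooth_onI) (intro exI[of _ UNIV] exI[of _ "\<lambda>x. c"], simp add: Ck_on_const)

lemma smooth_on_sum:
  assumes "\<And>i. i \<in> I \<Longrightarrow> smooth_on S (f i)"
  shows "smooth_on S (\<lambda>x. \<Sum>i\<in>I. f i x)"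
  using assms
  by (induction I rule: infinite_finite_induct) (auto intro: smooth_on_const smooth_on_add)

lemma smooth_on_tangential_part:
  assumes "smooth_on S n" "smooth_on S w"
  shows "smooth_on S (\<lambda>x. tangential_part (n x) (w x))"
proof -
  have "smooth_on S (\<lambda>x. w x + - ((w x \<bullet> n x) *\<^sub>R n x))"
    using assms
    by (intro smooth_on_add smooth_on_linear_compose[OF bounded_linear_minus[OF bounded_linear_ident]]
        smooth_on_bilinear[OF bounded_bilinear_scaleR] smooth_on_bilinear[OF bounded_bilinear_inner])
  then show ?thesis by (simp add: tangential_part_def)
qed

text \<open>Valid for every set \<open>M\<close>: it will serve the boundary surface and the closure
  of the domain alike.\<close>

lemma surface_has_derivative:
  assumes "smooth_on M f" "x \<in> M"
  shows "(f has_derivative surface_deriv M f x) (at x within M)"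
proof -
  obtain V g where V: "open V" "x \<in> V" "\<And>k. Ck_on k V g" "\<And>y. y \<in> V \<inter> M \<Longrightarrow> f y = g y"
    using smooth_onE[OF assms] by blast
  have "(f has_derivative frechet_derivative g (at x)) (at x within M)"
    by (rule has_derivative_within_local_eq[OF V(1,2) assms(2) V(4) Ck_on_Suc_has_derivative[OF V(3) V(2)]])
  then have "f differentiable (at x within M)" by (auto simp: differentiable_def)
  then show ?thesis unfolding surface_deriv_def frechet_derivative_works .
qed

lemma smooth_on_continuous_on:
  fixes f :: "real^3 \<Rightarrow> 'b::real_normed_vector"
  assumes "smooth_on S f"
  shows "continuous_on S f"
  unfolding continuous_on_eq_continuous_within
proof
  fix x assume "x \<in> S"
  then show "continuous (at x within S) f"
    using has_derivative_continuous surface_has_derivative[OF assms] by blast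
qed

lemma surface_deriv_extension:
  assumes "open V" "x \<in> V" "Ck_on (Suc 0) V g" "\<And>y. y \<in> V \<inter> M \<Longrightarrow> f y = g y"
    and "x \<in> M" "v \<in> tangent_space M x"
  shows "surface_deriv M f x v = frechet_derivative g (at x) v"
  by (rule surface_deriv_eq[OF has_derivative_within_local_eq[OF assms(1,2,5,4)
        Ck_on_Suc_has_derivative[OF assms(3,2)]] assms(6)])

text \<open>The direction varies with the point. Expanding it along the axes leaves derivatives of
  an extension of \<open>Y\<close> in fixed directions, weighted by the components of an extension
  of \<open>X\<close>; this expression makes sense off \<open>M\<close>.\<close>

lemma smooth_on_surface_deriv:
  assumes "smooth_on M Y" "smooth_tangent_field M X"
  shows "smooth_on M (\<lambda>x. surface_deriv M Y x (X x))"
proof (rule smooth_onI)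
  fix x assume x: "x \<in> M"
  have X: "smooth_on M X" "\<And>y. y \<in> M \<Longrightarrow> X y \<in> tangent_space M y"
    using assms(2) by (auto simp: smooth_tangent_field_def tangent_field_def)
  obtain V g where V: "open V" "x \<in> V" "\<And>k. Ck_on k V g" "\<And>y. y \<in> V \<inter> M \<Longrightarrow> Y y = g y"
    using smooth_onE[OF assms(1) x] by blast
  obtain W h where W: "open W" "x \<in> W" "\<And>k. Ck_on k W h" "\<And>y. y \<in> W \<inter> M \<Longrightarrow> X y = h y"
    using smooth_onE[OF X(1) x] by blast
  let ?f = "\<lambda>y. \<Sum>i\<in>UNIV. (h y $ i) *\<^sub>R frechet_derivative g (at y) (axis i 1)"
  have o: "open (V \<inter> W)" using V W by auto
  have "Ck_on k (V \<inter> W) (\<lambda>y. frechet_derivative g (at y) v)" for k v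
    using V(3)[of "Suc k"] by (auto intro: Ck_on_subset[of k V])
  moreover have "Ck_on k (V \<inter> W) h" for k
    using W(3) by (auto intro: Ck_on_subset[of k W])
  ultimately have Ck: "Ck_on k (V \<inter> W) ?f" for k
    by (intro Ck_on_sum[OF o] Ck_on_bilinear[OF o bounded_bilinear_scaleR]
        Ck_on_linear_compose[OF o bounded_linear_vec_nth]) auto
  have "surface_deriv M Y y (X y) = ?f y" if y: "y \<in> V \<inter> W \<inter> M" for y
  proof -
    have "surface_deriv M Y y (X y) = frechet_derivative g (at y) (X y)"
      by (rule surface_deriv_extension[OF V(1) _ V(3) V(4)]) (use y X(2) in auto)
    also have "\<dots> = ?f y"
      using W(4) y linear_axis_expansion[OF has_derivative_linear[OF Ck_on_Suc_has_derivative[OF V(3)]], of y "X y"]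
      by auto
    finally show ?thesis .
  qed
  then show "\<exists>V f. open V \<and> x \<in> V \<and> (\<forall>k. Ck_on k V f) \<and>
      (\<forall>y\<in>V \<inter> M. surface_deriv M Y y (X y) = f y)"
    using Ck o V(2) W(2) by (intro exI[of _ "V \<inter> W"] exI[of _ ?f]) auto
qed

section \<open>The Levi-Civita connection of the boundary\<close>

context smooth_domain
begin

abbreviation "\<Gamma> \<equiv> frontier \<Omega>"

lemma smooth_normal: "smooth_on \<Gamma> \<nu>"
proof (rule smooth_onI)
  fix x assume "x \<in> \<Gamma>"
  then show "\<exists>V g. open V \<and> x \<in> V \<and> (\<forall>k. Ck_on k V g) \<and> (\<forall>y\<in>V \<inter> \<Gamma>. \<nu> y = g y)"
    using normal_extension by metis
qed

lemma second_fundamental_form_symmetric: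
  assumes "x \<in> \<Gamma>" "v \<in> tangent_space \<Gamma> x" "w \<in> tangent_space \<Gamma> x"
  shows "second_fundamental_form \<Gamma> \<nu> x v w = second_fundamental_form \<Gamma> \<nu> x w v"
proof -
  obtain V N where V: "open V" "x \<in> V" "\<And>k. Ck_on k V N" "\<And>y. y \<in> V \<inter> \<Gamma> \<Longrightarrow> \<nu> y = N y"
    "\<And>v w. v \<bullet> \<nu> x = 0 \<Longrightarrow> w \<bullet> \<nu> x = 0 \<Longrightarrow>
       frechet_derivative N (at x) v \<bullet> w = frechet_derivative N (at x) w \<bullet> v"
    using normal_extension[OF assms(1)] by blast
  show ?thesis
    using surface_deriv_extension[OF V(1,2,3,4) assms(1)] assms V(5)
    by (simp add: second_fundamental_form_def tangent_space_iff)
qed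

text \<open>Differentiating \<open>Y y \<bullet> \<nu> y = 0\<close> along the surface moves the
  derivative from the field to the normal. This gives both the tangency of Lie brackets and the
  normal component of the advection term.\<close>

lemma weingarten:
  assumes Y: "smooth_tangent_field \<Gamma> Y" and x: "x \<in> \<Gamma>" and v: "v \<in> tangent_space \<Gamma> x"
  shows "surface_deriv \<Gamma> Y x v \<bullet> \<nu> x = - second_fundamental_form \<Gamma> \<nu> x v (Y x)"
proof -
  have Ys: "smooth_on \<Gamma> Y" and Yt: "\<And>y. y \<in> \<Gamma> \<Longrightarrow> Y y \<bullet> \<nu> y = 0"
    using Y by (auto simp: smooth_tangent_field_def tangent_field_def tangent_space_iff)
  have "((\<lambda>y. Y y \<bullet> \<nu> y) has_derivative
      (\<lambda>v. Y x \<bullet> surface_deriv \<Gamma> \<nu> x v + surface_deriv \<Gamma> Y x v \<bullet> \<nu> x)) (at x within \<Gamma>)"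
    by (rule has_derivative_inner[OF surface_has_derivative[OF Ys x]
          surface_has_derivative[OF smooth_normal x]])
  moreover have "((\<lambda>y. Y y \<bullet> \<nu> y) has_derivative (\<lambda>v. 0)) (at x within \<Gamma>)"
    by (rule has_derivative_transform[OF x _ has_derivative_const[of 0]]) (simp add: Yt)
  ultimately have "Y x \<bullet> surface_deriv \<Gamma> \<nu> x v + surface_deriv \<Gamma> Y x v \<bullet> \<nu> x = 0"
    using derivative_within_unique_tangent v by meson
  then show ?thesis
    by (simp add: second_fundamental_form_def inner_commute)
qed

section \<open>Tangential projection and the induced connection\<close>

lemma inner_tangential_part:
  assumes "x \<in> \<Gamma>" "v \<in> tangent_space \<Gamma> x"
  shows "tangential_part (\<nu> x) w \<bullet> v = w \<bullet> v" "v \<bullet> tangential_part (\<nu> x) w = v \<bullet> w"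
  using assms by (simp_all add: tangential_part_def tangent_space_iff inner_diff_left inner_diff_right
      inner_commute[of "\<nu> x"])

lemma tangential_part_in_tangent_space:
  assumes "x \<in> \<Gamma>"
  shows "tangential_part (\<nu> x) w \<in> tangent_space \<Gamma> x"
  using norm_normal[OF assms] assms
  by (simp add: tangential_part_def tangent_space_iff inner_diff_left dot_square_norm)

lemma tangential_part_tangent:
  "x \<in> \<Gamma> \<Longrightarrow> v \<in> tangent_space \<Gamma> x \<Longrightarrow> tangential_part (\<nu> x) v = v"
  by (simp add: tangential_part_def tangent_space_iff)

lemma smooth_tangent_field_tangential_part:
  "smooth_on \<Gamma> w \<Longrightarrow> smooth_tangent_field \<Gamma> (\<lambda>x. tangential_part (\<nu> x) (w x))"
  by (auto simp: smooth_tangent_field_def tangent_field_def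
      intro: smooth_on_tangential_part smooth_normal tangential_part_in_tangent_space)

text \<open>The explicit candidate for the Levi-Civita connection, as for any surface in Euclidean
  space: the ambient derivative without its normal component.\<close>

definition projected_derivative ::
  "(real^3 \<Rightarrow> real^3) \<Rightarrow> real^3 \<Rightarrow> real^3 \<Rightarrow> real^3" where
  "projected_derivative Y x v = tangential_part (\<nu> x) (surface_deriv \<Gamma> Y x v)"

lemma linear_tangential_part: "linear (tangential_part n)"
  unfolding tangential_part_def
  by (intro linearI) (auto simp: algebra_simps inner_add_left)

text \<open>The projected difference is the projected bracket, so the bracket has to be tangent
  already. Its normal components are values of the second fundamental form with exchanged arguments,
  and they cancel.\<close>

lemma projected_derivative_torsion_free:
  assumes X: "smooth_tangent_field \<Gamma> X" and Y: "smooth_tangent_field \<Gamma> Y" and x: "x \<in> \<Gamma>"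
  shows "projected_derivative Y x (X x) - projected_derivative X x (Y x) = lie_bracket \<Gamma> X Y x"
proof -
  have t: "X x \<in> tangent_space \<Gamma> x" "Y x \<in> tangent_space \<Gamma> x"
    using X Y x by (auto simp: smooth_tangent_field_def tangent_field_def)
  have "lie_bracket \<Gamma> X Y x \<bullet> \<nu> x = 0"
    unfolding lie_bracket_def inner_diff_left weingarten[OF Y x t(1)] weingarten[OF X x t(2)]
    using second_fundamental_form_symmetric[OF x t] by simp
  then have "tangential_part (\<nu> x) (lie_bracket \<Gamma> X Y x) = lie_bracket \<Gamma> X Y x"
    by (simp add: tangential_part_def)
  then show ?thesis
    by (simp add: projected_derivative_def lie_bracket_def linear_diff[OF linear_tangential_part])
qed

lemma projected_derivative_affine: "affine_connection \<Gamma> projected_derivative"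
  unfolding affine_connection_def
proof (intro conjI allI impI ballI)
  fix X Y assume "smooth_tangent_field \<Gamma> X \<and> smooth_tangent_field \<Gamma> Y"
  then show "smooth_tangent_field \<Gamma> (\<lambda>x. projected_derivative Y x (X x))"
    unfolding projected_derivative_def
    by (intro smooth_tangent_field_tangential_part smooth_on_surface_deriv)
      (auto simp: smooth_tangent_field_def)
next
  fix Y x v w and c d :: real
  assume "smooth_tangent_field \<Gamma> Y" "x \<in> \<Gamma>"
  then have "linear (surface_deriv \<Gamma> Y x)"
    by (intro has_derivative_linear[OF surface_has_derivative]) (simp_all add: smooth_tangent_field_def)
  then show "projected_derivative Y x (c *\<^sub>R v + d *\<^sub>R w) =
      c *\<^sub>R projected_derivative Y x v + d *\<^sub>R projected_derivative Y x w"
    using linear_tangential_part[of "\<nu> x"]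
    by (simp add: projected_derivative_def linear_add linear_cmul)
next
  fix Y Z x v
  assume YZ: "smooth_tangent_field \<Gamma> Y \<and> smooth_tangent_field \<Gamma> Z" and x: "x \<in> \<Gamma>"
    and v: "v \<in> tangent_space \<Gamma> x"
  have "surface_deriv \<Gamma> (\<lambda>y. Y y + Z y) x v = surface_deriv \<Gamma> Y x v + surface_deriv \<Gamma> Z x v"
    by (rule surface_deriv_eq[OF has_derivative_add v])
      (use YZ x surface_has_derivative in \<open>auto simp: smooth_tangent_field_def\<close>)
  then show "projected_derivative (\<lambda>y. Y y + Z y) x v =
      projected_derivative Y x v + projected_derivative Z x v"
    by (simp add: projected_derivative_def linear_add[OF linear_tangential_part])
next
  fix f :: "real^3 \<Rightarrow> real" and Y x v
  assume fY: "smooth_on \<Gamma> f \<and> smooth_tangent_field \<Gamma> Y" and x: "x \<in> \<Gamma>"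
    and v: "v \<in> tangent_space \<Gamma> x"
  have "surface_deriv \<Gamma> (\<lambda>y. f y *\<^sub>R Y y) x v =
      f x *\<^sub>R surface_deriv \<Gamma> Y x v + surface_deriv \<Gamma> f x v *\<^sub>R Y x"
    by (rule surface_deriv_eq[OF has_derivative_scaleR v])
      (use fY x surface_has_derivative in \<open>auto simp: smooth_tangent_field_def\<close>)
  moreover have "tangential_part (\<nu> x) (Y x) = Y x"
    using fY x tangential_part_tangent by (auto simp: smooth_tangent_field_def tangent_field_def)
  ultimately show "projected_derivative (\<lambda>y. f y *\<^sub>R Y y) x v =
      surface_deriv \<Gamma> f x v *\<^sub>R Y x + f x *\<^sub>R projected_derivative Y x v"
    using linear_tangential_part[of "\<nu> x"]
    by (simp add: projected_derivative_def linear_add linear_cmul)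
qed

lemma projected_derivative_metric:
  assumes Y: "smooth_tangent_field \<Gamma> Y" and Z: "smooth_tangent_field \<Gamma> Z" and x: "x \<in> \<Gamma>"
    and v: "v \<in> tangent_space \<Gamma> x"
  shows "surface_deriv \<Gamma> (\<lambda>y. Y y \<bullet> Z y) x v =
    projected_derivative Y x v \<bullet> Z x + Y x \<bullet> projected_derivative Z x v"
proof -
  have "surface_deriv \<Gamma> (\<lambda>y. Y y \<bullet> Z y) x v =
      Y x \<bullet> surface_deriv \<Gamma> Z x v + surface_deriv \<Gamma> Y x v \<bullet> Z x"
    by (rule surface_deriv_eq[OF has_derivative_inner v])
      (use Y Z x surface_has_derivative in \<open>auto simp: smooth_tangent_field_def\<close>)
  then show ?thesis
    using Y Z x
    by (simp add: projected_derivative_def inner_tangential_part smooth_tangent_field_def tangent_field_def)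
qed

lemma projected_derivative_levi_civita: "is_levi_civita \<Gamma> projected_derivative"
  unfolding is_levi_civita_def
  using projected_derivative_affine projected_derivative_metric projected_derivative_torsion_free
  by blast

text \<open>The difference of two such connections, paired with a third field, is symmetric in the
  first two and antisymmetric in the last two arguments, hence zero.\<close>

lemma levi_civita_unique:
  assumes D: "is_levi_civita \<Gamma> D" and Y: "smooth_tangent_field \<Gamma> Y" and x: "x \<in> \<Gamma>"
    and v: "v \<in> tangent_space \<Gamma> x"
  shows "D Y x v = projected_derivative Y x v"
proof -
  define E where "E Y v = D Y x v - projected_derivative Y x v" for Y v
  \<comment> \<open>Extends a vector to a smooth tangent field, by projecting the constant field.
    Identities known for fields thereby apply to single tangent vectors at \<open>x\<close>.\<close>
  define F where "F w = (\<lambda>y. tangential_part (\<nu> y) w)" for w :: "real^3"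
  have F: "smooth_tangent_field \<Gamma> (F w)" for w
    unfolding F_def by (intro smooth_tangent_field_tangential_part smooth_on_const)
  have Fx: "F w x = w" if "w \<in> tangent_space \<Gamma> x" for w
    using that x by (simp add: F_def tangential_part_tangent)
  have ten: "X x \<in> tangent_space \<Gamma> x" if "smooth_tangent_field \<Gamma> X" for X
    using that x by (simp add: smooth_tangent_field_def tangent_field_def)
  have sym: "E Y (X x) = E X (Y x)"
    if "smooth_tangent_field \<Gamma> X" "smooth_tangent_field \<Gamma> Y" for X Y
  proof -
    have "D Y x (X x) - D X x (Y x) = lie_bracket \<Gamma> X Y x"
      using D that x by (auto simp: is_levi_civita_def)
    then show ?thesis
      using projected_derivative_torsion_free[OF that x] unfolding E_def
      by (simp add: algebra_simps)
  qed
  have anti: "E Y (X x) \<bullet> Z x = - (E Z (X x) \<bullet> Y x)"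
    if "smooth_tangent_field \<Gamma> X" "smooth_tangent_field \<Gamma> Y" "smooth_tangent_field \<Gamma> Z" for X Y Z
  proof -
    have "surface_deriv \<Gamma> (\<lambda>y. Y y \<bullet> Z y) x (X x) = D Y x (X x) \<bullet> Z x + Y x \<bullet> D Z x (X x)"
      using D that x ten[OF that(1)] by (auto simp: is_levi_civita_def)
    then show ?thesis
      using projected_derivative_metric[OF that(2,3) x ten[OF that(1)]]
      by (simp add: E_def inner_diff_left inner_diff_right inner_commute)
  qed
  \<comment> \<open>Alternating \<open>anti\<close> and \<open>sym\<close> permutes the three fields
    cyclically and returns to the initial expression after three changes of sign.\<close>
  have zero: "E Y (X x) \<bullet> Z x = 0"
    if "smooth_tangent_field \<Gamma> X" "smooth_tangent_field \<Gamma> Y" "smooth_tangent_field \<Gamma> Z" for X Y Z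
  proof -
    have "E Y (X x) \<bullet> Z x = - (E Z (X x) \<bullet> Y x)" using anti that by blast
    also have "\<dots> = - (E X (Z x) \<bullet> Y x)" using sym[of X Z] that by simp
    also have "\<dots> = E Y (Z x) \<bullet> X x" using anti[of Z X Y] that by simp
    also have "\<dots> = E Z (Y x) \<bullet> X x" using sym[of Z Y] that by simp
    also have "\<dots> = - (E X (Y x) \<bullet> Z x)" using anti[of Y Z X] that by simp
    also have "\<dots> = - (E Y (X x) \<bullet> Z x)" using sym[of X Y] that by simp
    finally show ?thesis by simp
  qed
  \<comment> \<open>An affine connection is known to take tangent values only along smooth tangent
    fields, so \<open>v\<close> is first written as the value of \<open>F v\<close>.\<close>
  have "D Y x (F v x) \<in> tangent_space \<Gamma> x"
  proof -
    have "smooth_tangent_field \<Gamma> (\<lambda>x. D Y x (F v x))"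
      using D Y F by (auto simp: is_levi_civita_def affine_connection_def)
    from ten[OF this] show ?thesis .
  qed
  moreover have "projected_derivative Y x v \<in> tangent_space \<Gamma> x"
    unfolding projected_derivative_def by (rule tangential_part_in_tangent_space[OF x])
  ultimately have "E Y v \<in> tangent_space \<Gamma> x"
    using x by (simp add: E_def Fx[OF v] tangent_space_iff inner_diff_left)
  then have "E Y v \<bullet> E Y v = 0"
    using zero[OF F Y F, of v "E Y v"] by (simp add: Fx v)
  then show ?thesis by (simp add: E_def)
qed

text \<open>The projected derivative shows that the choice in \<open>levi_civita\<close> has a
  witness; uniqueness then fixes the chosen values.\<close>

lemma levi_civita_eq:
  assumes "smooth_tangent_field \<Gamma> Y" "x \<in> \<Gamma>" "v \<in> tangent_space \<Gamma> x"
  shows "levi_civita \<Gamma> Y x v = projected_derivative Y x v"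
proof -
  have "is_levi_civita \<Gamma> (levi_civita \<Gamma>)"
    unfolding levi_civita_def
    by (rule someI[where P="is_levi_civita \<Gamma>", OF projected_derivative_levi_civita])
  then show ?thesis using levi_civita_unique assms by blast
qed

end

section \<open>Oriented frames and the surface curl\<close>

lemma bounded_bilinear_cross3: "bounded_bilinear cross3"
  using bilinear_cross bilinear_conv_bounded_bilinear by blast

text \<open>The cross product \<open>c\<close> is a unit vector and parallel to \<open>n\<close>,
  both by Lagrange's identities, so it is \<open>n\<close> or \<open>- n\<close>. The sign of the
  determinant decides.\<close>

lemma oriented_orthonormal_cross3:
  fixes e1 e2 n :: "real^3"
  assumes "norm e1 = 1" "norm e2 = 1" "norm n = 1" "e1 \<bullet> e2 = 0" "e1 \<bullet> n = 0" "e2 \<bullet> n = 0"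
    and "0 < det (vector [e1, e2, n] :: real^3^3)"
  shows "cross3 e1 e2 = n"
proof -
  define c where "c = cross3 e1 e2"
  have "(norm c)\<^sup>2 = 1" unfolding c_def norm_cross using assms by simp
  then have cc: "c \<bullet> c = 1" by (simp add: power2_norm_eq_inner)
  have "cross3 n c = 0" unfolding c_def Lagrange using assms by (simp add: inner_commute)
  then have "cross3 c (cross3 n c) = 0" by simp
  then have n: "n = (c \<bullet> n) *\<^sub>R c" unfolding Lagrange cc by simp
  have "norm c = 1" using cc by (simp add: norm_eq_sqrt_inner)
  then have "\<bar>c \<bullet> n\<bar> = 1" using n assms(3) by (metis norm_scaleR mult.right_neutral real_norm_def)
  moreover have "c \<bullet> n = e1 \<bullet> cross3 e2 n" unfolding c_def by (metis cross_triple inner_commute)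
  then have "c \<bullet> n > 0" using assms(7) by (simp add: dot_cross_det)
  ultimately show ?thesis using n by (simp add: c_def)
qed

text \<open>The curl as a function of the derivative alone: twice the axial vector of the
  antisymmetric part of \<open>L\<close>. It can be applied to derivatives within any set.\<close>

definition curl_of :: "(real^3 \<Rightarrow> real^3) \<Rightarrow> real^3" where
  "curl_of L = (\<Sum>i\<in>UNIV. cross3 (axis i 1) (L (axis i 1)))"

lemma curl_of_eq_vector:
  "curl_of L = vector
     [L (axis 2 1) $ 3 - L (axis 3 1) $ 2,
      L (axis 3 1) $ 1 - L (axis 1 1) $ 3,
      L (axis 1 1) $ 2 - L (axis 2 1) $ 1]"
proof -
  have "cross3 (axis 1 1) z = vector [0, - z $ 3, z $ 2]"
    "cross3 (axis 2 1) z = vector [z $ 3, 0, - z $ 1]"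
    "cross3 (axis 3 1) z = vector [- z $ 2, z $ 1, 0]" for z
    by (simp_all add: cross3_def axis_def)
  then show ?thesis unfolding curl_of_def sum_3 by (simp only: vec_eq_iff forall_3 vector_3 vector_add_component) simp
qed

text \<open>The Binet-Cauchy identity for each axis, after which the sums reassemble
  \<open>L\<close>. Only the values of \<open>L\<close> at \<open>v\<close> and \<open>w\<close>
  enter, so the normal component of a curl on the boundary depends on tangential derivatives
  alone.\<close>

lemma curl_of_inner_cross3:
  assumes "linear L"
  shows "curl_of L \<bullet> cross3 v w = L v \<bullet> w - L w \<bullet> v"
proof -
  have "curl_of L \<bullet> cross3 v w =
      (\<Sum>i\<in>UNIV. (v $ i) *\<^sub>R L (axis i 1) \<bullet> w - (w $ i) *\<^sub>R L (axis i 1) \<bullet> v)"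
    by (simp add: curl_of_def inner_sum_left dot_cross inner_axis' inner_axis)
  also have "\<dots> = L v \<bullet> w - L w \<bullet> v"
    by (simp only: sum_subtractf flip: inner_sum_left linear_axis_expansion[OF assms])
  finally show ?thesis .
qed

context smooth_domain
begin

text \<open>Supplies the witness for \<open>THE\<close> in \<open>surface_curl\<close>. A fixed
  vector \<open>b\<close> not parallel to the normal at \<open>x\<close> gives the tangent field
  \<open>F\<close>, nonzero near \<open>x\<close>; \<open>e1\<close> is \<open>F\<close> normalised,
  and \<open>e2\<close> is \<open>e1\<close> turned by a right angle about the normal. The frame
  conditions are checked on the boundary, where \<open>N\<close> is the unit normal.\<close>

lemma oriented_frame_exists:
  assumes x: "x \<in> \<Gamma>"
  obtains U e1 e2 where "oriented_frame \<Gamma> \<nu> U e1 e2" "x \<in> U"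
proof -
  obtain V N where V: "open V" "x \<in> V" "\<And>k. Ck_on k V N" "\<And>y. y \<in> V \<inter> \<Gamma> \<Longrightarrow> \<nu> y = N y"
    by (rule smooth_onE[OF smooth_normal x]) blast
  have "\<nu> x \<noteq> 0" using norm_normal[OF x] by auto
  then obtain b where "cross3 (\<nu> x) b \<noteq> 0" using cross_basis_nonzero by blast
  define F where "F y = cross3 (N y) b" for y
  have Fx: "F x \<noteq> 0" using V x \<open>cross3 (\<nu> x) b \<noteq> 0\<close> by (simp add: F_def)
  have CkF: "Ck_on k V F" for k
    unfolding F_def
    by (rule Ck_on_linear_compose[OF V(1) bounded_bilinear.bounded_linear_left[OF bounded_bilinear_cross3] V(3)])
  define W where "W = {y\<in>V. F y \<noteq> 0}"
  have "continuous_on V F" using CkF[of 0] by simp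
  then have oW: "open W"
    using continuous_open_preimage[OF _ V(1) open_Compl[OF closed_singleton[of "0::real^3"]]]
    by (simp add: W_def vimage_def Int_def conj_commute)
  have WV: "W \<subseteq> V" by (auto simp: W_def)
  define e1 where "e1 y = (F y \<bullet> F y) powr (- 1/2) *\<^sub>R F y" for y
  define e2 where "e2 y = cross3 (N y) (e1 y)" for y
  have Ck1: "Ck_on k W e1" for k
    unfolding e1_def using Ck_on_subset[OF CkF WV]
    by (intro Ck_on_bilinear[OF oW bounded_bilinear_scaleR] Ck_on_powr[OF oW]
        Ck_on_bilinear[OF oW bounded_bilinear_inner]) (auto simp: W_def)
  have Ck2: "Ck_on k W e2" for k
    unfolding e2_def using Ck_on_subset[OF V(3) WV] Ck1
    by (intro Ck_on_bilinear[OF oW bounded_bilinear_cross3])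
  have "oriented_frame \<Gamma> \<nu> (W \<inter> \<Gamma>) e1 e2"
    unfolding oriented_frame_def
  proof (intro conjI ballI)
    show "openin (top_of_set \<Gamma>) (W \<inter> \<Gamma>)" using oW by (auto simp: openin_open)
    show "smooth_on (W \<inter> \<Gamma>) e1" "smooth_on (W \<inter> \<Gamma>) e2"
      using oW Ck1 Ck2 by (auto intro!: smooth_onI)
  next
    fix y assume y: "y \<in> W \<inter> \<Gamma>"
    then have N: "N y = \<nu> y" and F0: "F y \<noteq> 0" using V(4) WV by (auto simp: W_def)
    have nn: "\<nu> y \<bullet> \<nu> y = 1" using norm_normal y by (simp add: dot_square_norm)
    show n1: "norm (e1 y) = 1"
      using F0 by (simp add: e1_def powr_minus powr_half_sqrt flip: norm_eq_sqrt_inner)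
    have o1: "e1 y \<bullet> \<nu> y = 0" by (simp add: e1_def F_def N dot_cross_self)
    show "e1 y \<in> tangent_space \<Gamma> y" using o1 y by (simp add: tangent_space_iff)
    show "e2 y \<in> tangent_space \<Gamma> y" using y by (simp add: tangent_space_iff e2_def N dot_cross_self)
    have "(norm (e2 y))\<^sup>2 = 1"
      unfolding e2_def norm_cross N using n1 o1 norm_normal y by (simp add: inner_commute)
    then show "norm (e2 y) = 1" by (simp add: power2_eq_1_iff) (use norm_ge_zero[of "e2 y"] in linarith)
    show "e1 y \<bullet> e2 y = 0" by (simp add: e2_def dot_cross_self)
    have "cross3 (e2 y) (\<nu> y) = - cross3 (\<nu> y) (cross3 (\<nu> y) (e1 y))"
      unfolding e2_def N by (rule cross_skew)
    also have "\<dots> = e1 y" unfolding Lagrange using nn o1 by (simp add: inner_commute)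
    finally have "e1 y \<bullet> cross3 (e2 y) (\<nu> y) = 1" using n1 by (simp add: dot_square_norm)
    then show "0 < det (vector [e1 y, e2 y, \<nu> y] :: real^3^3)" by (simp add: dot_cross_det)
  qed
  moreover have "x \<in> W \<inter> \<Gamma>" using x V(2) Fx by (auto simp: W_def)
  ultimately show ?thesis using that by blast
qed

text \<open>\<open>L\<close> may be any derivative of \<open>w\<close> within the boundary, for its
  values off the tangent plane do not influence \<open>curl_of L \<bullet> \<nu> x\<close>.\<close>

lemma surface_curl_tangential_part:
  assumes w: "smooth_on \<Gamma> w" and a: "\<And>y. y \<in> \<Gamma> \<Longrightarrow> a y = tangential_part (\<nu> y) (w y)"
    and x: "x \<in> \<Gamma>" and L: "(w has_derivative L) (at x within \<Gamma>)"
  shows "surface_curl \<Gamma> \<nu> a x = curl_of L \<bullet> \<nu> x"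
proof -
  have "smooth_tangent_field \<Gamma> (\<lambda>y. tangential_part (\<nu> y) (w y))"
    by (rule smooth_tangent_field_tangential_part[OF w])
  then have sa: "smooth_tangent_field \<Gamma> a"
    using a unfolding smooth_tangent_field_def tangent_field_def smooth_on_def by (metis IntD2)
  have lin: "linear L" using L by (rule has_derivative_linear)
  \<comment> \<open>The derivative of the coefficient \<open>w y \<bullet> \<nu> y\<close>
    multiplies the normal and disappears when paired with the tangent vector
    \<open>z\<close>.\<close>
  have d: "surface_deriv \<Gamma> a x v \<bullet> z = L v \<bullet> z - (w x \<bullet> \<nu> x) * second_fundamental_form \<Gamma> \<nu> x v z"
    if v: "v \<in> tangent_space \<Gamma> x" and z: "z \<in> tangent_space \<Gamma> x" for v z
  proof -
    let ?n = "surface_deriv \<Gamma> \<nu> x"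
    have "((\<lambda>y. w y - (w y \<bullet> \<nu> y) *\<^sub>R \<nu> y) has_derivative
        (\<lambda>v. L v - ((w x \<bullet> \<nu> x) *\<^sub>R ?n v + (w x \<bullet> ?n v + L v \<bullet> \<nu> x) *\<^sub>R \<nu> x))) (at x within \<Gamma>)"
      by (intro has_derivative_diff has_derivative_scaleR has_derivative_inner L
          surface_has_derivative[OF smooth_normal x])
    then have "(a has_derivative
        (\<lambda>v. L v - ((w x \<bullet> \<nu> x) *\<^sub>R ?n v + (w x \<bullet> ?n v + L v \<bullet> \<nu> x) *\<^sub>R \<nu> x))) (at x within \<Gamma>)"
      by (rule has_derivative_transform[OF x, rotated]) (simp add: a tangential_part_def)
    from surface_deriv_eq[OF this v] show ?thesis
      using z x by (simp add: inner_diff_left inner_add_left second_fundamental_form_def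
          tangent_space_iff inner_commute[of "\<nu> x"])
  qed
  \<comment> \<open>The value does not depend on the frame, which is the uniqueness that
    \<open>THE\<close> requires.\<close>
  have frame: "levi_civita \<Gamma> a x (e1 x) \<bullet> e2 x - levi_civita \<Gamma> a x (e2 x) \<bullet> e1 x = curl_of L \<bullet> \<nu> x"
    if f: "oriented_frame \<Gamma> \<nu> U e1 e2" "x \<in> U" for U e1 e2
  proof -
    have t: "e1 x \<in> tangent_space \<Gamma> x" "e2 x \<in> tangent_space \<Gamma> x"
      and on: "norm (e1 x) = 1" "norm (e2 x) = 1" "e1 x \<bullet> e2 x = 0"
      "0 < det (vector [e1 x, e2 x, \<nu> x] :: real^3^3)"
      using f by (auto simp: oriented_frame_def)
    have "cross3 (e1 x) (e2 x) = \<nu> x"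
      using t x by (intro oriented_orthonormal_cross3 on norm_normal) (auto simp: tangent_space_iff)
    then have "curl_of L \<bullet> \<nu> x = L (e1 x) \<bullet> e2 x - L (e2 x) \<bullet> e1 x"
      using curl_of_inner_cross3[OF lin] by metis
    then show ?thesis
      using second_fundamental_form_symmetric[OF x t]
      by (simp add: levi_civita_eq[OF sa x] projected_derivative_def t inner_tangential_part x d)
  qed
  obtain U e1 e2 where "oriented_frame \<Gamma> \<nu> U e1 e2" "x \<in> U" using oriented_frame_exists[OF x] .
  then show ?thesis
    unfolding surface_curl_def using frame
    by (intro the_equality) metis+
qed

end

section \<open>Calculus on the closure of the domain\<close>

context smooth_domain
begin

abbreviation "S \<equiv> closure \<Omega>"

abbreviation dS :: "(real^3 \<Rightarrow> 'b::real_normed_vector) \<Rightarrow> real^3 \<Rightarrow> real^3 \<Rightarrow> 'b" where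
  "dS f x \<equiv> frechet_derivative f (at x within S)"

lemma dS_extension:
  assumes "open V" "x \<in> V" "\<And>k. Ck_on k V g" "\<And>y. y \<in> V \<inter> S \<Longrightarrow> f y = g y" "x \<in> S"
  shows "dS f x = frechet_derivative g (at x)"
  by (rule frechet_derivative_closure[OF assms(1,2,5,4) Ck_on_Suc_has_derivative[OF assms(3,2)]])

lemma dS_eq:
  assumes "x \<in> S" "(f has_derivative D) (at x within S)"
  shows "dS f x = D"
proof -
  have "f differentiable (at x within S)" using assms(2) by (auto simp: differentiable_def)
  then show ?thesis
    using assms derivative_within_closure_unique frechet_derivative_works by blast
qed

lemma dS_has_derivative:
  assumes "smooth_on S f" "x \<in> S"
  shows "(f has_derivative dS f x) (at x within S)"
  using surface_has_derivative[OF assms] by (simp add: surface_deriv_def[abs_def])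

lemma linear_dS: "smooth_on S f \<Longrightarrow> x \<in> S \<Longrightarrow> linear (dS f x)"
  by (rule has_derivative_linear[OF dS_has_derivative])

lemma dS_cong:
  assumes "\<And>y. y \<in> S \<Longrightarrow> f y = g y" "x \<in> S"
  shows "dS f x = dS g x"
proof -
  have "(f has_derivative D) (at x within S) \<longleftrightarrow> (g has_derivative D) (at x within S)" for D
    using has_derivative_transform[OF assms(2), of f g] has_derivative_transform[OF assms(2), of g f] assms(1)
    by auto
  then show ?thesis by (simp add: frechet_derivative_def)
qed

lemma dS_linear_compose:
  assumes "bounded_linear L" "smooth_on S f" "x \<in> S"
  shows "dS (\<lambda>y. L (f y)) x v = L (dS f x v)"
  by (simp add: dS_eq[OF assms(3) bounded_linear.has_derivative[OF assms(1) dS_has_derivative[OF assms(2,3)]]])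

lemma dS_sum:
  assumes "\<And>i. i \<in> I \<Longrightarrow> smooth_on S (f i)" "x \<in> S"
  shows "dS (\<lambda>y. \<Sum>i\<in>I. f i y) x v = (\<Sum>i\<in>I. dS (f i) x v)"
  by (simp add: dS_eq[OF assms(2) has_derivative_sum[OF dS_has_derivative[OF assms]]])

lemma dS_add:
  assumes "smooth_on S f" "smooth_on S g" "x \<in> S"
  shows "dS (\<lambda>y. f y + g y) x v = dS f x v + dS g x v"
  by (simp add: dS_eq[OF assms(3) has_derivative_add[OF dS_has_derivative[OF assms(1,3)]
          dS_has_derivative[OF assms(2,3)]]])

lemma dS_zero:
  assumes "\<And>y. y \<in> S \<Longrightarrow> f y = 0" "x \<in> S"
  shows "dS f x v = 0"
proof -
  have "dS f x = dS (\<lambda>_. 0) x" using assms by (intro dS_cong)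
  then show ?thesis by (simp only: dS_eq[OF assms(2) has_derivative_const])
qed

text \<open>On all of \<open>V \<inter> S\<close> the derivative within the closure is that of one
  extension, so differentiating the extension extends the derivative. Higher derivatives up to the
  boundary are thereby accessible.\<close>

lemma smooth_on_dS:
  assumes "smooth_on S f"
  shows "smooth_on S (\<lambda>x. dS f x v)"
proof (rule smooth_onI)
  fix x assume x: "x \<in> S"
  obtain V g where V: "open V" "x \<in> V" "\<And>k. Ck_on k V g" "\<And>y. y \<in> V \<inter> S \<Longrightarrow> f y = g y"
    using smooth_onE[OF assms x] by blast
  have "Ck_on k V (\<lambda>y. frechet_derivative g (at y) v)" for k
    using V(3)[of "Suc k"] by simp
  then show "\<exists>V g. open V \<and> x \<in> V \<and> (\<forall>k. Ck_on k V g) \<and> (\<forall>y\<in>V \<inter> S. dS f y v = g y)"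
    using V dS_extension[OF V(1) _ V(3,4)]
    by (intro exI[of _ V] exI[of _ "\<lambda>y. frechet_derivative g (at y) v"]) auto
qed

lemma dS_symmetric:
  fixes f :: "real^3 \<Rightarrow> 'b::euclidean_space"
  assumes "smooth_on S f" "x \<in> S"
  shows "dS (\<lambda>y. dS f y v) x w = dS (\<lambda>y. dS f y w) x v"
proof -
  obtain V g where V: "open V" "x \<in> V" "\<And>k. Ck_on k V g" "\<And>y. y \<in> V \<inter> S \<Longrightarrow> f y = g y"
    using smooth_onE[OF assms] by blast
  have "dS (\<lambda>y. dS f y v) x = frechet_derivative (\<lambda>y. frechet_derivative g (at y) v) (at x)" for v
  proof (rule dS_extension[OF V(1,2) _ _ assms(2)])
    show "Ck_on k V (\<lambda>y. frechet_derivative g (at y) v)" for k using V(3)[of "Suc k"] by simp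
    show "dS f y v = frechet_derivative g (at y) v" if "y \<in> V \<inter> S" for y
      using dS_extension[OF V(1) _ V(3,4)] that by simp
  qed
  then show ?thesis using second_derivative_symmetric[OF V(1,2) V(3)] by simp
qed

lemma zero_on_closure:
  fixes f :: "real^3 \<Rightarrow> 'b::real_normed_vector"
  assumes "smooth_on S f" "\<And>x. x \<in> \<Omega> \<Longrightarrow> f x = 0" "x \<in> S"
  shows "f x = 0"
  using continuous_constant_on_closure[OF smooth_on_continuous_on[OF assms(1)] assms(2,3)] .

lemma laplacian_closure: "laplacian S f x = (\<Sum>i\<in>UNIV. dS (\<lambda>y. dS f y (axis i 1)) x (axis i 1))"
  by (simp add: laplacian_def partial_def[abs_def])

lemma grad_closure: "grad S f x $ i = dS f x (axis i 1)"
  by (simp add: grad_def partial_def)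

lemma divergence_closure:
  "smooth_on S f \<Longrightarrow> x \<in> S \<Longrightarrow> divergence S f x = (\<Sum>i\<in>UNIV. dS f x (axis i 1) $ i)"
  by (simp add: divergence_def partial_def dS_linear_compose[OF bounded_linear_vec_nth])

lemma curl_closure:
  "smooth_on S f \<Longrightarrow> x \<in> S \<Longrightarrow> curl S f x = curl_of (dS f x)"
  by (simp add: curl_def partial_def dS_linear_compose[OF bounded_linear_vec_nth] curl_of_eq_vector)

lemma advection_closure:
  "smooth_on S f \<Longrightarrow> x \<in> S \<Longrightarrow> advection S v f x = dS f x (v x)"
  using linear_axis_expansion[OF linear_dS, of f x "v x"] by (simp add: advection_def partial_def)

lemma smooth_on_laplacian: "smooth_on S f \<Longrightarrow> smooth_on S (laplacian S f)"
  unfolding laplacian_closure[abs_def] by (intro smooth_on_sum smooth_on_dS)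

lemma smooth_on_grad:
  assumes "smooth_on S f"
  shows "smooth_on S (grad S f)"
proof -
  have "grad S f = (\<lambda>y. \<Sum>i\<in>UNIV. dS f y (axis i 1) *\<^sub>R axis i 1)"
    by (simp only: fun_eq_iff vec_eq_iff sum_axis_component grad_closure) simp
  then show ?thesis
    using smooth_on_sum[OF smooth_on_linear_compose[OF bounded_linear_scaleR_left smooth_on_dS[OF assms]]]
    by simp
qed

lemma smooth_on_divergence:
  assumes "smooth_on S f"
  shows "smooth_on S (divergence S f)"
  by (rule smooth_on_eq[OF smooth_on_sum[OF smooth_on_linear_compose[OF bounded_linear_vec_nth
          smooth_on_dS[OF assms]]] divergence_closure[OF assms]])

lemma smooth_on_curl:
  assumes "smooth_on S f"
  shows "smooth_on S (curl S f)"
  by (rule smooth_on_eq[OF smooth_on_sum[OF smooth_on_linear_compose[OF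
          bounded_bilinear.bounded_linear_right[OF bounded_bilinear_cross3] smooth_on_dS[OF assms]]]])
    (simp add: curl_closure[OF assms] curl_of_def)

lemma smooth_on_advection:
  assumes "smooth_on S v" "smooth_on S f"
  shows "smooth_on S (advection S v f)"
  unfolding advection_def[abs_def] partial_def
  by (intro smooth_on_sum smooth_on_bilinear[OF bounded_bilinear_scaleR] smooth_on_dS assms
      smooth_on_linear_compose[OF bounded_linear_vec_nth])

section \<open>Second and third order identities up to the boundary\<close>

lemma divergence_laplacian:
  assumes f: "smooth_on S f" and x: "x \<in> S"
  shows "divergence S (laplacian S f) x = laplacian S (divergence S f) x"
proof -
  let ?e = "\<lambda>i. axis i 1 :: real^3"
  let ?g = "\<lambda>j y. dS f y (?e j)"
  have g: "smooth_on S (?g j)" for j by (rule smooth_on_dS[OF f])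
  have gg: "smooth_on S (\<lambda>y. dS (?g j) y v)" for j v by (rule smooth_on_dS[OF g])
  \<comment> \<open>Two exchanges in a third derivative: first of the two outer differentiations,
    then of the two inner ones under the remaining derivative.\<close>
  have swap: "dS (\<lambda>y. dS (?g j) y (?e j)) x (?e i) = dS (\<lambda>y. dS (?g i) y (?e j)) x (?e j)" for i j
  proof -
    have "dS (\<lambda>y. dS (?g j) y (?e j)) x (?e i) = dS (\<lambda>y. dS (?g j) y (?e i)) x (?e j)"
      by (rule dS_symmetric[OF g x])
    also have "\<dots> = dS (\<lambda>y. dS (?g i) y (?e j)) x (?e j)"
      by (intro fun_cong[OF dS_cong[OF _ x]] dS_symmetric[OF f])
    finally show ?thesis .
  qed
  have "divergence S (laplacian S f) x =
      (\<Sum>i\<in>UNIV. \<Sum>j\<in>UNIV. dS (\<lambda>y. dS (?g i) y (?e j)) x (?e j) $ i)"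
    unfolding divergence_closure[OF smooth_on_laplacian[OF f] x]
    unfolding laplacian_closure[abs_def] dS_sum[OF gg x] by (simp add: swap)
  also have "\<dots> = (\<Sum>j\<in>UNIV. \<Sum>i\<in>UNIV. dS (\<lambda>y. dS (?g i) y (?e j)) x (?e j) $ i)"
    by (rule sum.swap)
  also have "\<dots> = (\<Sum>j\<in>UNIV. dS (\<lambda>y. dS (divergence S f) y (?e j)) x (?e j))"
  proof (rule sum.cong)
    fix j :: 3
    have "dS (divergence S f) y (?e j) = (\<Sum>i\<in>UNIV. dS (?g i) y (?e j) $ i)" if y: "y \<in> S" for y
      using dS_cong[OF divergence_closure[OF f] y]
      by (simp add: dS_sum[OF smooth_on_linear_compose[OF bounded_linear_vec_nth g] y]
          dS_linear_compose[OF bounded_linear_vec_nth g y])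
    then have "dS (\<lambda>y. dS (divergence S f) y (?e j)) x =
        dS (\<lambda>y. \<Sum>i\<in>UNIV. dS (?g i) y (?e j) $ i) x"
      by (rule dS_cong[OF _ x])
    then show "(\<Sum>i\<in>UNIV. dS (\<lambda>y. dS (?g i) y (?e j)) x (?e j) $ i) =
        dS (\<lambda>y. dS (divergence S f) y (?e j)) x (?e j)"
      by (simp add: dS_sum[OF smooth_on_linear_compose[OF bounded_linear_vec_nth gg] x]
          dS_linear_compose[OF bounded_linear_vec_nth gg x])
  qed simp
  finally show ?thesis by (simp add: laplacian_closure)
qed

text \<open>Lagrange's formula splits each double cross product of axis vectors with a second
  derivative. The first parts sum to the gradient of the divergence, the diagonal ones to the
  Laplacian.\<close>

lemma curl_curl:
  assumes f: "smooth_on S f" and x: "x \<in> S"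
  shows "curl_of (dS (curl S f) x) = grad S (divergence S f) x - laplacian S f x"
proof -
  let ?e = "\<lambda>i. axis i 1 :: real^3"
  let ?g = "\<lambda>j y. dS f y (?e j)"
  have g: "smooth_on S (?g j)" for j by (rule smooth_on_dS[OF f])
  let ?H = "\<lambda>j i. dS (?g j) x (?e i)"
  have bl: "bounded_linear (cross3 b)" for b
    by (rule bounded_bilinear.bounded_linear_right[OF bounded_bilinear_cross3])
  have dcurl: "dS (curl S f) x (?e i) = (\<Sum>j\<in>UNIV. cross3 (?e j) (?H j i))" for i
    using dS_cong[OF curl_closure[OF f] x, unfolded curl_of_def]
    by (simp add: dS_sum[OF smooth_on_linear_compose[OF bl g] x] dS_linear_compose[OF bl g x])
  have ddiv: "dS (divergence S f) x (?e i) = (\<Sum>j\<in>UNIV. ?H j i $ j)" for i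
    using dS_cong[OF divergence_closure[OF f] x]
    by (simp add: dS_sum[OF smooth_on_linear_compose[OF bounded_linear_vec_nth g] x]
        dS_linear_compose[OF bounded_linear_vec_nth g x])
  have H: "?H j i = ?H i j" for i j by (rule dS_symmetric[OF f x])
  have cc: "cross3 (?e i) (cross3 (?e j) (?H j i)) =
      (?H i j $ i) *\<^sub>R ?e j - (if i = j then ?H j i else 0)" for i j
    by (simp add: Lagrange inner_axis_axis inner_axis' H[of j i]) (simp add: axis_def)
  have "curl_of (dS (curl S f) x) = (\<Sum>i\<in>UNIV. \<Sum>j\<in>UNIV. cross3 (?e i) (cross3 (?e j) (?H j i)))"
    by (simp add: curl_of_def dcurl linear_sum[OF bounded_linear.linear[OF bl]])
  also have "\<dots> = (\<Sum>i\<in>UNIV. \<Sum>j\<in>UNIV. (?H i j $ i) *\<^sub>R ?e j - (if i = j then ?H j i else 0))"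
    by (intro sum.cong refl) (simp add: cc)
  also have "\<dots> = (\<Sum>j\<in>UNIV. (\<Sum>i\<in>UNIV. ?H i j $ i) *\<^sub>R ?e j) - (\<Sum>i\<in>UNIV. ?H i i)"
    by (simp add: sum_subtractf scaleR_left.sum sum.swap[of "\<lambda>i j. (?H i j $ i) *\<^sub>R ?e j"])
  also have "(\<Sum>j\<in>UNIV. (\<Sum>i\<in>UNIV. ?H i j $ i) *\<^sub>R ?e j) = grad S (divergence S f) x"
    by (simp only: vec_eq_iff sum_axis_component grad_closure ddiv) (simp add: H)
  finally show ?thesis by (simp add: laplacian_closure)
qed

lemma laplacian_normal:
  assumes f: "smooth_on S f" and div: "\<And>y. y \<in> S \<Longrightarrow> divergence S f y = 0" and x: "x \<in> \<Gamma>"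
    and a: "\<And>y. y \<in> \<Gamma> \<Longrightarrow> a y = tangential_part (\<nu> y) (curl S f y)"
  shows "laplacian S f x \<bullet> \<nu> x = - surface_curl \<Gamma> \<nu> a x"
proof -
  have \<Gamma>S: "\<Gamma> \<subseteq> S" by (simp add: frontier_def)
  then have xS: "x \<in> S" using x by auto
  have w: "smooth_on S (curl S f)" by (rule smooth_on_curl[OF f])
  \<comment> \<open>A derivative within the closure is also one within its subset
    \<open>\<Gamma>\<close>, so the surface formula applies to the vorticity.\<close>
  have "surface_curl \<Gamma> \<nu> a x = curl_of (dS (curl S f) x) \<bullet> \<nu> x"
    by (rule surface_curl_tangential_part[OF smooth_on_subset[OF w \<Gamma>S] a x
          has_derivative_subset[OF dS_has_derivative[OF w xS] \<Gamma>S]])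
  moreover have "grad S (divergence S f) x = 0"
    by (simp add: vec_eq_iff grad_closure dS_zero[OF div xS])
  ultimately show ?thesis by (simp add: curl_curl[OF f xS])
qed

lemma advection_normal:
  assumes f: "smooth_on S f" and no_flux: "\<And>y. y \<in> \<Gamma> \<Longrightarrow> f y \<bullet> \<nu> y = 0" and x: "x \<in> \<Gamma>"
  shows "advection S f f x \<bullet> \<nu> x = - second_fundamental_form \<Gamma> \<nu> x (f x) (f x)"
proof -
  have \<Gamma>S: "\<Gamma> \<subseteq> S" by (simp add: frontier_def)
  then have xS: "x \<in> S" using x by auto
  have F: "smooth_tangent_field \<Gamma> f"
    using smooth_on_subset[OF f \<Gamma>S] no_flux
    by (simp add: smooth_tangent_field_def tangent_field_def tangent_space_iff)
  have t: "f x \<in> tangent_space \<Gamma> x" using no_flux x by (simp add: tangent_space_iff)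
  have "surface_deriv \<Gamma> f x (f x) = dS f x (f x)"
    by (rule surface_deriv_eq[OF has_derivative_subset[OF dS_has_derivative[OF f xS] \<Gamma>S] t])
  then show ?thesis
    using weingarten[OF F x t] by (simp add: advection_closure[OF f xS])
qed

section \<open>Time slices of smooth fields\<close>

lemma smooth_on_time_slice:
  fixes f :: "real \<Rightarrow> real^3 \<Rightarrow> 'b::real_normed_vector"
  assumes "smooth_on (I \<times> S) (\<lambda>(t, x). f t x)" "t \<in> I"
  shows "smooth_on S (f t)"
proof (rule smooth_onI)
  fix x assume "x \<in> S"
  then have "(t, x) \<in> I \<times> S" using assms(2) by simp
  then obtain W G where W: "open W" "(t, x) \<in> W" "\<And>k. Ck_on k W G"
    "\<And>z. z \<in> W \<inter> I \<times> S \<Longrightarrow> (\<lambda>(t, x). f t x) z = G z"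
    using smooth_onE[OF assms(1)] by blast
  have "open {y. (t, y) \<in> W}"
    by (rule open_slice(1)[OF W(1)])
  then show "\<exists>V g. open V \<and> x \<in> V \<and> (\<forall>k. Ck_on k V g) \<and> (\<forall>y\<in>V \<inter> S. f t y = g y)"
    using Ck_on_slice[OF W(1,3)] W(2,4) assms(2)
    by (intro exI[of _ "{y. (t, y) \<in> W}"] exI[of _ "\<lambda>y. G (t, y)"]) force
qed

end

section \<open>The pressure of a Navier-Stokes flow\<close>

locale smooth_family = smooth_domain +
  fixes u :: "real \<Rightarrow> real^3 \<Rightarrow> real^3" and T :: real
  assumes smooth_u: "smooth_on ({0<..T} \<times> closure \<Omega>) (\<lambda>(t, x). u t x)"
begin

abbreviation ut :: "real \<Rightarrow> real^3 \<Rightarrow> real^3" where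
  "ut t x \<equiv> vector_derivative (\<lambda>s. u s x) (at t within {0<..T})"

text \<open>A single extension \<open>G\<close> represents the field, its time derivative and its
  spatial derivatives at once, also at the final time and at the boundary. Exchanging time and space
  derivatives becomes symmetry of the second derivative of \<open>G\<close>.\<close>

lemma space_time_extension:
  assumes "t \<in> {0<..T}" "x \<in> S"
  obtains W G where "open W" "(t, x) \<in> W" "\<And>k. Ck_on k W G"
    "\<And>s y. (s, y) \<in> W \<Longrightarrow> s \<in> {0<..T} \<Longrightarrow> y \<in> S \<Longrightarrow> u s y = G (s, y)"
    "\<And>s y. (s, y) \<in> W \<Longrightarrow> s \<in> {0<..T} \<Longrightarrow> y \<in> S \<Longrightarrow> ut s y = frechet_derivative G (at (s, y)) (1, 0)"
    "\<And>s y v. (s, y) \<in> W \<Longrightarrow> s \<in> {0<..T} \<Longrightarrow> y \<in> S \<Longrightarrow> dS (u s) y v = frechet_derivative G (at (s, y)) (0, v)"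
proof -
  obtain W G where W: "open W" "(t, x) \<in> W" "\<And>k. Ck_on k W G"
    "\<And>z. z \<in> W \<inter> {0<..T} \<times> S \<Longrightarrow> (\<lambda>(t, x). u t x) z = G z"
    using smooth_onE[OF smooth_u] assms by blast
  have eq: "u s y = G (s, y)" if "(s, y) \<in> W" "s \<in> {0<..T}" "y \<in> S" for s y
    using W(4)[of "(s, y)"] that by simp
  show ?thesis
  proof (rule that[OF W(1,2,3) eq])
    fix s y assume sy: "(s, y) \<in> W" "s \<in> {0<..T}" "y \<in> S"
    note dG = Ck_on_Suc_has_derivative[OF W(3) sy(1)]
    have "open {r. (r, y) \<in> W}"
      by (rule open_slice(2)[OF W(1)])
    then have "((\<lambda>r. u r y) has_vector_derivative frechet_derivative G (at (s, y)) (1, 0)) (at s within {0<..T})"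
      unfolding has_vector_derivative_def
      by (rule has_derivative_within_local_eq[OF _ _ sy(2) _
            has_vector_derivative_slice[OF dG, unfolded has_vector_derivative_def]]) (use sy eq in auto)
    \<comment> \<open>Every \<open>s\<close> in the half-open interval, including \<open>T\<close>,
      is a limit point of it, so the derivative within it is unique.\<close>
    then show "ut s y = frechet_derivative G (at (s, y)) (1, 0)"
      using sy(2) by (intro vector_derivative_within) (auto simp: trivial_limit_within)
    have "open {z. (s, z) \<in> W}"
      by (rule open_slice(1)[OF W(1)])
    then have "dS (u s) y = (\<lambda>v. frechet_derivative G (at (s, y)) (0, v))"
      by (rule frechet_derivative_closure[OF _ _ sy(3) _ has_derivative_slice[OF dG]]) (use sy eq in auto)
    then show "dS (u s) y v = frechet_derivative G (at (s, y)) (0, v)" for v by simp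
  qed
qed

lemma smooth_on_ut:
  assumes t: "t \<in> {0<..T}"
  shows "smooth_on S (ut t)"
proof (rule smooth_onI)
  fix x assume x: "x \<in> S"
  obtain W G where W: "open W" "(t, x) \<in> W" "\<And>k. Ck_on k W G"
    "\<And>s y. (s, y) \<in> W \<Longrightarrow> s \<in> {0<..T} \<Longrightarrow> y \<in> S \<Longrightarrow> ut s y = frechet_derivative G (at (s, y)) (1, 0)"
    using space_time_extension[OF t x] by metis
  have "open {y. (t, y) \<in> W}"
    by (rule open_slice(1)[OF W(1)])
  moreover have "Ck_on k W (\<lambda>z. frechet_derivative G (at z) (1, 0))" for k
    using W(3)[of "Suc k"] by simp
  ultimately show "\<exists>V g. open V \<and> x \<in> V \<and> (\<forall>k. Ck_on k V g) \<and> (\<forall>y\<in>V \<inter> S. ut t y = g y)"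
    using W t Ck_on_slice[OF W(1), of _ "\<lambda>z. frechet_derivative G (at z) (1, 0)" t]
    by (intro exI[of _ "{y. (t, y) \<in> W}"] exI[of _ "\<lambda>y. frechet_derivative G (at (t, y)) (1, 0)"]) auto
qed

lemma left_interval_in:
  assumes "open W" "(t, x) \<in> W" "t \<in> {0<..T}"
  obtains \<delta> where "0 < \<delta>" "\<And>s. t - \<delta> < s \<Longrightarrow> s \<le> t \<Longrightarrow> (s, x) \<in> W \<and> s \<in> {0<..T}"
proof -
  have "open {r. (r, x) \<in> W}"
    by (rule open_slice(2)[OF assms(1)])
  then obtain e where e: "e > 0" "ball t e \<subseteq> {r. (r, x) \<in> W}"
    using assms(2) openE by blast
  show ?thesis
    \<comment> \<open>The bound \<open>e\<close> keeps the points in \<open>W\<close>, the bound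
      \<open>t\<close> keeps the times positive.\<close>
    by (rule that[of "min e t"]) (use e assms(3) in \<open>auto simp: subset_eq dist_real_def\<close>)
qed

text \<open>The vector \<open>n\<close> is fixed because the boundary and its normal do not move in
  time; the vanishing component is then differentiated from the left.\<close>

lemma ut_normal:
  assumes t: "t \<in> {0<..T}" and x: "x \<in> S" and n: "\<And>s. s \<in> {0<..T} \<Longrightarrow> u s x \<bullet> n = 0"
  shows "ut t x \<bullet> n = 0"
proof -
  obtain W G where W: "open W" "(t, x) \<in> W" "\<And>k. Ck_on k W G"
    "\<And>s y. (s, y) \<in> W \<Longrightarrow> s \<in> {0<..T} \<Longrightarrow> y \<in> S \<Longrightarrow> u s y = G (s, y)"
    "\<And>s y. (s, y) \<in> W \<Longrightarrow> s \<in> {0<..T} \<Longrightarrow> y \<in> S \<Longrightarrow> ut s y = frechet_derivative G (at (s, y)) (1, 0)"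
    using space_time_extension[OF t x] by metis
  obtain \<delta> where \<delta>: "0 < \<delta>" "\<And>s. t - \<delta> < s \<Longrightarrow> s \<le> t \<Longrightarrow> (s, x) \<in> W \<and> s \<in> {0<..T}"
    using left_interval_in[OF W(1,2) t] by blast
  have "((\<lambda>s. G (s, x) \<bullet> n) has_vector_derivative ut t x \<bullet> n) (at t)"
    using has_vector_derivative_slice[OF Ck_on_Suc_has_derivative[OF W(3,2)]] W(5)[OF W(2) t x]
    by (auto intro: bounded_linear.has_vector_derivative[OF bounded_linear_inner_left])
  then show ?thesis
    by (rule zero_one_sided_derivative[OF _ \<delta>(1)]) (use \<delta>(2) W(4) x n in metis)
qed

text \<open>Symmetry of the second derivative of \<open>G\<close> turns the divergence of
  \<open>ut\<close> into the time derivative of the divergence of \<open>u\<close>, which vanishes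
  for all times up to \<open>t\<close>.\<close>

lemma divergence_ut:
  assumes t: "t \<in> {0<..T}" and x: "x \<in> S" and div: "\<And>s. s \<in> {0<..T} \<Longrightarrow> divergence S (u s) x = 0"
  shows "divergence S (ut t) x = 0"
proof -
  let ?e = "\<lambda>i. axis i 1 :: real^3"
  obtain W G where W: "open W" "(t, x) \<in> W" "\<And>k. Ck_on k W G"
    and ut: "\<And>s y. (s, y) \<in> W \<Longrightarrow> s \<in> {0<..T} \<Longrightarrow> y \<in> S \<Longrightarrow> ut s y = frechet_derivative G (at (s, y)) (1, 0)"
    and du: "\<And>s y v. (s, y) \<in> W \<Longrightarrow> s \<in> {0<..T} \<Longrightarrow> y \<in> S \<Longrightarrow> dS (u s) y v = frechet_derivative G (at (s, y)) (0, v)"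
    using space_time_extension[OF t x] by metis
  obtain \<delta> where \<delta>: "0 < \<delta>" "\<And>s. t - \<delta> < s \<Longrightarrow> s \<le> t \<Longrightarrow> (s, x) \<in> W \<and> s \<in> {0<..T}"
    using left_interval_in[OF W(1,2) t] by blast
  let ?G = "\<lambda>v z. frechet_derivative G (at z) v"
  have dG: "(?G v has_derivative frechet_derivative (?G v) (at (t, x))) (at (t, x))" for v
    by (rule Ck_on_2_has_derivative(2)[OF W(3,2)])
  have "open {y. (t, y) \<in> W}"
    by (rule open_slice(1)[OF W(1)])
  then have "dS (ut t) x = (\<lambda>v. frechet_derivative (?G (1, 0)) (at (t, x)) (0, v))"
    by (rule frechet_derivative_closure[OF _ _ x _ has_derivative_slice[OF dG]]) (use W(2) t ut in auto)
  then have "divergence S (ut t) x =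
      (\<Sum>i\<in>UNIV. frechet_derivative (?G (0, ?e i)) (at (t, x)) (1, 0) $ i)"
    using second_derivative_symmetric[OF W(1,2) W(3)]
    by (simp add: divergence_closure[OF smooth_on_ut[OF t] x])
  also have "\<dots> = 0"
  proof (rule zero_one_sided_derivative[OF _ \<delta>(1)])
    show "((\<lambda>s. \<Sum>i\<in>UNIV. ?G (0, ?e i) (s, x) $ i) has_vector_derivative
        (\<Sum>i\<in>UNIV. frechet_derivative (?G (0, ?e i)) (at (t, x)) (1, 0) $ i)) (at t)"
      by (intro has_vector_derivative_sum bounded_linear.has_vector_derivative[OF bounded_linear_vec_nth]
          has_vector_derivative_slice dG)
    fix s assume "t - \<delta> < s" "s \<le> t"
    then have s: "(s, x) \<in> W" "s \<in> {0<..T}" using \<delta>(2) by auto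
    then show "(\<Sum>i\<in>UNIV. ?G (0, ?e i) (s, x) $ i) = 0"
      using div[OF s(2)] divergence_closure[OF smooth_on_time_slice[OF smooth_u s(2)] x] du[OF s x] by simp
  qed
  finally show ?thesis .
qed

end

theorem lemma4p1:
  fixes \<Omega> :: "(real^3) set" and \<nu> :: "real^3 \<Rightarrow> real^3"
    and u a :: "real \<Rightarrow> real^3 \<Rightarrow> real^3" and p :: "real \<Rightarrow> real^3 \<Rightarrow> real"
    and \<mu> T :: real
  assumes domain: "bounded_smooth_domain \<Omega>"
    and normal: "outward_unit_normal \<Omega> \<nu>"
    and "0 < \<mu>" and "0 < T"
    and smooth_u: "smooth_on ({0<..T} \<times> closure \<Omega>) (\<lambda>(t, x). u t x)"
    and smooth_p: "smooth_on ({0<..T} \<times> closure \<Omega>) (\<lambda>(t, x). p t x)"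
    and momentum: "\<And>t x. t \<in> {0<..T} \<Longrightarrow> x \<in> \<Omega> \<Longrightarrow>
      vector_derivative (\<lambda>s. u s x) (at t within {0<..T})
        + advection (closure \<Omega>) (u t) (u t) x + grad (closure \<Omega>) (p t) x
      = \<mu> *\<^sub>R laplacian (closure \<Omega>) (u t) x"
    and incompressible: "\<And>t x. t \<in> {0<..T} \<Longrightarrow> x \<in> \<Omega> \<Longrightarrow> divergence (closure \<Omega>) (u t) x = 0"
    and tangential: "\<And>t. t \<in> {0<..T} \<Longrightarrow> tangent_field (frontier \<Omega>) (a t)"
    and no_flux: "\<And>t x. t \<in> {0<..T} \<Longrightarrow> x \<in> frontier \<Omega> \<Longrightarrow> u t x \<bullet> \<nu> x = 0"
    and vorticity: "\<And>t x. t \<in> {0<..T} \<Longrightarrow> x \<in> frontier \<Omega> \<Longrightarrow>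
      tangential_part (\<nu> x) (curl (closure \<Omega>) (u t) x) = a t x"
  shows "\<forall>t\<in>{0<..T}.
    (\<forall>x\<in>\<Omega>. laplacian (closure \<Omega>) (p t) x
       = - divergence (closure \<Omega>) (advection (closure \<Omega>) (u t) (u t)) x) \<and>
    (\<forall>x\<in>frontier \<Omega>. grad (closure \<Omega>) (p t) x \<bullet> \<nu> x
       = second_fundamental_form (frontier \<Omega>) \<nu> x (u t x) (u t x)
         - \<mu> * surface_curl (frontier \<Omega>) \<nu> (a t) x)"
proof
  interpret smooth_family \<Omega> \<nu> u T
    by unfold_locales (fact domain normal smooth_u)+
  fix t assume t: "t \<in> {0<..T}"
  have su: "smooth_on S (u s)" if "s \<in> {0<..T}" for s by (rule smooth_on_time_slice[OF smooth_u that])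
  have sp: "smooth_on S (p t)" by (rule smooth_on_time_slice[OF smooth_p t])
  note sut = smooth_on_ut[OF t] and sadv = smooth_on_advection[OF su[OF t] su[OF t]]
    and sgrad = smooth_on_grad[OF sp] and slap = smooth_on_laplacian[OF su[OF t]]
  have div0: "divergence S (u s) x = 0" if "s \<in> {0<..T}" "x \<in> S" for s x
    using zero_on_closure[OF smooth_on_divergence[OF su[OF that(1)]] _ that(2)] incompressible that(1) by blast
  \<comment> \<open>The residual of the momentum equation, smooth on the closure and therefore zero
    up to the boundary. Its divergence yields the Poisson equation, its normal component the Neumann
    condition.\<close>
  define R where "R x = ut t x + advection S (u t) (u t) x + grad S (p t) x + (- \<mu>) *\<^sub>R laplacian S (u t) x" for x
  have slap': "smooth_on S (\<lambda>x. (- \<mu>) *\<^sub>R laplacian S (u t) x)"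
    by (rule smooth_on_linear_compose[OF bounded_linear_scaleR_right slap])
  note s2 = smooth_on_add[OF sut sadv]
  note s3 = smooth_on_add[OF s2 sgrad]
  have sR: "smooth_on S R" unfolding R_def by (rule smooth_on_add[OF s3 slap'])
  have R0: "R x = 0" if "x \<in> S" for x
    by (rule zero_on_closure[OF sR _ that]) (simp add: R_def momentum[OF t])
  show "(\<forall>x\<in>\<Omega>. laplacian S (p t) x = - divergence S (advection S (u t) (u t)) x) \<and>
    (\<forall>x\<in>\<Gamma>. grad S (p t) x \<bullet> \<nu> x
       = second_fundamental_form \<Gamma> \<nu> x (u t x) (u t x) - \<mu> * surface_curl \<Gamma> \<nu> (a t) x)"
  proof (intro conjI ballI)
    fix x assume "x \<in> \<Omega>"
    then have x: "x \<in> S" using closure_subset by auto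
    have "0 = divergence S R x"
      by (simp add: divergence_closure[OF sR x] dS_zero[OF R0 x])
    also have "\<dots> = divergence S (ut t) x + divergence S (advection S (u t) (u t)) x
        + divergence S (grad S (p t)) x - \<mu> * divergence S (laplacian S (u t)) x"
      unfolding divergence_closure[OF sR x] divergence_closure[OF sut x] divergence_closure[OF sadv x]
        divergence_closure[OF sgrad x] divergence_closure[OF slap x]
      unfolding R_def dS_add[OF s3 slap' x] dS_add[OF s2 sgrad x] dS_add[OF sut sadv x]
        dS_linear_compose[OF bounded_linear_scaleR_right slap x]
      by (simp add: sum.distrib sum_subtractf sum_distrib_left)
    also have "divergence S (ut t) x = 0" by (rule divergence_ut[OF t x div0[OF _ x]])
    also have "divergence S (laplacian S (u t)) x = 0"
    proof -
      have "laplacian S (divergence S (u t)) x = 0"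
        \<comment> \<open>The divergence vanishes on the whole closure, and with it all its
          derivatives within that set.\<close>
        unfolding laplacian_closure by (intro sum.neutral ballI dS_zero x div0[OF t])
      then show ?thesis by (simp add: divergence_laplacian[OF su[OF t] x])
    qed
    also have "divergence S (grad S (p t)) x = laplacian S (p t) x"
      by (simp add: divergence_def laplacian_def grad_def partial_def[abs_def])
    finally show "laplacian S (p t) x = - divergence S (advection S (u t) (u t)) x" by simp
  next
    fix x assume x: "x \<in> \<Gamma>"
    then have xS: "x \<in> S" by (simp add: frontier_def)
    have "0 = R x \<bullet> \<nu> x" by (simp add: R0[OF xS])
    also have "\<dots> = ut t x \<bullet> \<nu> x + advection S (u t) (u t) x \<bullet> \<nu> x + grad S (p t) x \<bullet> \<nu> x
        - \<mu> * (laplacian S (u t) x \<bullet> \<nu> x)"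
      by (simp add: R_def inner_add_left inner_diff_left)
    also have "ut t x \<bullet> \<nu> x = 0" by (rule ut_normal[OF t xS no_flux[OF _ x]])
    also have "advection S (u t) (u t) x \<bullet> \<nu> x = - second_fundamental_form \<Gamma> \<nu> x (u t x) (u t x)"
      by (rule advection_normal[OF su[OF t] no_flux[OF t] x])
    also have "laplacian S (u t) x \<bullet> \<nu> x = - surface_curl \<Gamma> \<nu> (a t) x"
      by (rule laplacian_normal[OF su[OF t] div0[OF t] x vorticity[OF t, symmetric]])
    finally show "grad S (p t) x \<bullet> \<nu> x
       = second_fundamental_form \<Gamma> \<nu> x (u t x) (u t x) - \<mu> * surface_curl \<Gamma> \<nu> (a t) x"
      by simp
  qed
qed

end
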